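(* Let $x>0$ and let $m$ be a positive integer. Then $$\Gamma^*(x)=\sum_{n=0}^{m-1}\frac{(-1)^n\gamma_n}{x^n}+R_m(x),$$ where the Stirling coefficients satisfy, for all integers $n\ge 0$, $$\gamma_n=\frac{(-2)^n}{\sqrt{\pi}}\,\frac{\Gamma(n+\frac12)}{(2n)!}\,\frac{d^{2n}}{dt^{2n}}\big[\phi(t)^{2n+1}\big]_{t=0}=\frac{(-1)^n}{2^n\,n!}\,\frac{d^{2n}}{dt^{2n}}\big[\phi(t)^{2n+1}\big]_{t=0},$$ and the remainder is $$R_m(x)=\frac{x^{-m}}{\sqrt{2\pi}}\int_0^\infty e^{-w}\,w^{m+\frac12}\left(\frac{1}{2\pi i}\oint_{C}\frac{z\,h'(z)}{h(z)-w/x}\,\{h(z)\}^{-m-\frac12}\,dz\right)dw.$$ Here, for each $w>0$, $C=C_w$ is a closed contour described in the positive sense surrounding $z=0$ and the two real zeros (one positive and one negative) of $h(z)-w/x$.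
   Context: The scaled gamma function is $\Gamma^*(x)=\dfrac{\Gamma(x)}{\sqrt{2\pi}\,x^{x-\frac12}e^{-x}}$ for $x>0$. The Stirling coefficients $\gamma_n$ are defined by the Poincaré asymptotic expansion $\Gamma^*(x)\sim\sum_{n=0}^\infty(-1)^n\gamma_n x^{-n}$ as $x\to+\infty$. Define $$h(z)=e^z-z-1,\qquad \phi(t)=\left(\frac{\frac12t^2}{e^t-t-1}\right)^{1/2}=\left(1+2\sum_{r=1}^\infty\frac{t^r}{(r+2)!}\right)^{-1/2},\qquad \phi(0)=1,$$ where $\phi$ is the branch that is positive on the real line, continued analytically to a neighbourhood of it. The contour $C$ is simple and such that $\phi$ is analytic on and inside $C$, and such that $h(z)-w/x$ has no zeros on $C$ and no zeros inside $C$ other than the two real ones (for example, $C$ may be taken inside the strip $|\mathrm{Im}\, z|<2\pi$). The half-integer powers of $h$ are defined by $\{h(z)\}^{1/2}=z/(\sqrt2\,\phi(z))$ (positive for $z>0$, negative for $z<0$), and $\{h(z)\}^{-m-\frac12}=\big(\{h(z)\}^{1/2}\big)^{-2m-1}$. *)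

theory Defs
  imports "HOL-Complex_Analysis.Complex_Analysis" "HOL-Library.Landau_Symbols"
begin

definition scaled_Gamma :: "real \<Rightarrow> real" where
  "scaled_Gamma x = Gamma x / (sqrt (2 * pi) * x powr (x - 1/2) * exp (- x))"

definition asymp_power_expansion :: "(real \<Rightarrow> real) \<Rightarrow> (nat \<Rightarrow> real) \<Rightarrow> bool" where
  "asymp_power_expansion f a \<longleftrightarrow>
     (\<forall>N. (\<lambda>x. f x - (\<Sum>n<N. a n / x ^ n)) \<in> O[at_top](\<lambda>x. 1 / x ^ N))"

text \<open>A function has at most one asymptotic power expansion, so the definite description below
  picks out the Stirling coefficients as soon as \<^term>\<open>scaled_Gamma\<close> has one.\<close>

definition stirling_coeff :: "nat \<Rightarrow> real" where
  "stirling_coeff = (THE \<gamma>. asymp_power_expansion scaled_Gamma (\<lambda>n. (-1) ^ n * \<gamma> n))"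

definition stirling_h :: "complex \<Rightarrow> complex" where
  "stirling_h z = exp z - z - 1"

definition stirling_phi :: "real \<Rightarrow> real" where
  "stirling_phi t = (if t = 0 then 1 else sqrt ((t\<^sup>2 / 2) / (exp t - t - 1)))"

text \<open>\<^term>\<open>stirling_phi\<close> is the positive real branch; \<open>\<Phi>\<close> below is its analytic continuation to a
  neighbourhood of the real line and of the closed region bounded by the contour \<open>C\<close>.
  A principal-value square root would not do: its branch cuts meet the strip \<open>\<bar>Im z\<bar> < 2 \<pi>\<close>,
  where \<open>\<phi>\<close> is analytic. The parameter \<open>u\<close> stands for \<open>w / x\<close>.\<close>

definition stirling_contour :: "real \<Rightarrow> (complex \<Rightarrow> complex) \<Rightarrow> (real \<Rightarrow> complex) \<Rightarrow> bool" where
  "stirling_contour u \<Phi> C \<longleftrightarrow>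
     valid_path C \<and> simple_path C \<and> pathfinish C = pathstart C \<and>
     (\<forall>z\<in>inside (path_image C). winding_number C z = 1) \<and>
     0 \<in> inside (path_image C) \<and>
     (\<exists>a b :: real. a < 0 \<and> 0 < b \<and>
        of_real a \<in> inside (path_image C) \<and> of_real b \<in> inside (path_image C) \<and>
        {z \<in> path_image C \<union> inside (path_image C). stirling_h z - of_real u = 0}
          = {of_real a, of_real b}) \<and>
     \<Phi> analytic_on (\<real> \<union> path_image C \<union> inside (path_image C)) \<and>
     (\<forall>t::real. \<Phi> (of_real t) = of_real (stirling_phi t))"

definition stirling_h_sqrt :: "(complex \<Rightarrow> complex) \<Rightarrow> complex \<Rightarrow> complex" where
  "stirling_h_sqrt \<Phi> z = z / (of_real (sqrt 2) * \<Phi> z)"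

definition stirling_kernel ::
    "(complex \<Rightarrow> complex) \<Rightarrow> (real \<Rightarrow> complex) \<Rightarrow> nat \<Rightarrow> real \<Rightarrow> complex" where
  "stirling_kernel \<Phi> C m u =
     1 / (2 * of_real pi * \<i>) *
     contour_integral C (\<lambda>z. z * deriv stirling_h z / (stirling_h z - of_real u)
                              * stirling_h_sqrt \<Phi> z powi (- 2 * int m - 1))"

definition stirling_integrand ::
    "(real \<Rightarrow> complex \<Rightarrow> complex) \<Rightarrow> (real \<Rightarrow> real \<Rightarrow> complex) \<Rightarrow> nat \<Rightarrow> real \<Rightarrow> real \<Rightarrow> complex" where
  "stirling_integrand \<Phi> C m x w =
     of_real (exp (- w) * w powr (real m + 1/2)) * stirling_kernel (\<Phi> w) (C w) m (w / x)"

definition stirling_remainder ::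
    "(real \<Rightarrow> complex \<Rightarrow> complex) \<Rightarrow> (real \<Rightarrow> real \<Rightarrow> complex) \<Rightarrow> nat \<Rightarrow> real \<Rightarrow> complex" where
  "stirling_remainder \<Phi> C m x =
     of_real (1 / (x ^ m * sqrt (2 * pi))) *
     set_lebesgue_integral lborel {0<..} (stirling_integrand \<Phi> C m x)"

lemma stirling_h_real_pos:
  fixes t :: real
  assumes "t \<noteq> 0"
  shows "exp t - t - 1 > 0"
  using exp_minus_greater[of "-t"] assms by simp

lemma stirling_h_zero_real:
  assumes "stirling_h z = of_real u" "u \<ge> 0" "\<bar>Im z\<bar> < 2 * pi"
  shows "Im z = 0"
proof (rule ccontr)
  assume "Im z \<noteq> 0"
  define x y where "x = Re z" and "y = \<bar>Im z\<bar>"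
  have y: "0 < y" "y < 2 * pi" using assms \<open>Im z \<noteq> 0\<close> by (auto simp: y_def)
  have "exp x * cos (Im z) = x + 1 + u" "exp x * sin (Im z) = Im z"
    using assms(1) by (auto simp: stirling_h_def complex_eq_iff Re_exp Im_exp x_def)
  then have 1: "exp x * cos y = x + 1 + u" and 2: "exp x * sin y = y"
    by (auto simp: y_def abs_if)
  have sp: "sin y > 0"
    using 2 y by (metis exp_gt_zero zero_less_mult_pos)
  then have "y < pi" using y sin_le_zero[of y] by force
  have "sin y \<le> y" using y by (simp add: sin_x_le_x)
  then have "1 * sin y \<le> exp x * sin y" using 2 by simp
  then have "1 \<le> exp x" using sp mult_right_le_imp_le by blast
  then have "x \<ge> 0" by simp
  then have "1 \<le> exp x * cos y" using 1 assms(2) by simp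
  then have "1 * sin y \<le> (exp x * cos y) * sin y"
    using sp by (intro mult_right_mono) auto
  then have "sin y \<le> y * cos y" using 2 by (metis mult.commute mult.left_commute mult_1)
  moreover have "sin 0 - 0 * cos 0 < sin y - y * cos y"
  proof (rule DERIV_pos_imp_increasing_open[OF \<open>0 < y\<close>])
    fix t assume t: "0 < t" "t < y"
    have "((\<lambda>t. sin t - t * cos t) has_real_derivative t * sin t) (at t)"
      by (auto intro!: derivative_eq_intros)
    moreover have "t * sin t > 0" using t \<open>y < pi\<close> by (simp add: sin_gt_zero)
    ultimately show "\<exists>d. ((\<lambda>t. sin t - t * cos t) has_real_derivative d) (at t) \<and> d > 0" by blast
  qed (intro continuous_intros)
  ultimately show False by simp
qed

lemma stirling_h_real_zeros:
  assumes "u > 0"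
  obtains a b :: real where "a < 0" "0 < b"
    "\<And>t. exp t - t - 1 = u \<longleftrightarrow> t = a \<or> t = b"
proof -
  define f where "f = (\<lambda>t::real. exp t - t - 1)"
  have cf: "continuous_on A f" for A by (auto simp: f_def intro!: continuous_intros)
  have df: "(f has_real_derivative exp t - 1) (at t)" for t
    by (auto simp: f_def intro!: derivative_eq_intros)
  have f0: "f 0 = 0" by (simp add: f_def)
  have "1 + (u+2) + (u+2)\<^sup>2/2 \<le> exp (u+2)"
    using assms by (intro exp_lower_Taylor_quadratic) auto
  then have "f (u+2) \<ge> (u+2)\<^sup>2/2" by (simp add: f_def)
  moreover have "(u+2)\<^sup>2/2 \<ge> u" using assms by (simp add: power2_eq_square algebra_simps)
  ultimately have "f (u+2) \<ge> u" by simp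
  then obtain b where b: "0 \<le> b" "f b = u" 
    using IVT'[of f 0 u "u+2"] cf f0 assms by auto
  have "f (-(u+1)) \<ge> u" by (simp add: f_def)
  then obtain a where a: "a \<le> 0" "f a = u"
    using IVT2'[of f 0 u "-(u+1)"] cf f0 assms by auto
  have ab: "a < 0" "0 < b" using a b f0 assms by (auto simp: less_le)
  have inc: "f s < f t" if "0 \<le> s" "s < t" for s t
    using that(2)
  proof (rule DERIV_pos_imp_increasing_open)
    fix r assume "s < r" "r < t"
    then show "\<exists>y. (f has_real_derivative y) (at r) \<and> y > 0" using df[of r] that by auto
  qed (rule cf)
  have dec: "f s > f t" if "t \<le> 0" "s < t" for s t
    using that(2)
  proof (rule DERIV_neg_imp_decreasing_open)
    fix r assume "s < r" "r < t"
    then show "\<exists>y. (f has_real_derivative y) (at r) \<and> y < 0" using df[of r] that by auto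
  qed (rule cf)
  have "f t = u \<longleftrightarrow> t = a \<or> t = b" for t
    using inc[of t b] inc[of b t] dec[of t a] dec[of a t] a b
    by (smt (verit))
  then show thesis using ab that unfolding f_def by blast
qed

lemma stirling_phi_extends:
  obtains \<Phi> where "\<Phi> holomorphic_on {z. \<bar>Im z\<bar> < 2 * pi}"
    "\<And>t::real. \<Phi> (of_real t) = of_real (stirling_phi t)"
proof -
  define S where "S = {z. \<bar>Im z\<bar> < 2 * pi}"
  have S: "S = {z. Im z < 2 * pi} \<inter> {z. Im z > - (2 * pi)}" by (auto simp: S_def)
  have opS: "open S" unfolding S
    by (intro open_Int open_halfspace_Im_lt open_halfspace_Im_gt)
  have cvS: "convex S" unfolding S
    by (intro convex_Int convex_halfspace_Im_lt convex_halfspace_Im_gt)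
  define g where "g = (\<lambda>z. if z = 0 then 1 else 2 * stirling_h z / z\<^sup>2)"
  have "g holomorphic_on S"
  proof (rule no_isolated_singularity'[of "{0}"])
    have "g holomorphic_on (S - {0}) \<longleftrightarrow> (\<lambda>z. 2 * stirling_h z / z\<^sup>2) holomorphic_on (S - {0})"
      by (intro holomorphic_cong) (auto simp: g_def)
    also have "\<dots>" unfolding stirling_h_def by (intro holomorphic_intros) auto
    finally show "g holomorphic_on (S - {0})" .
  next
    fix z :: complex assume "z \<in> {0}"
    then have [simp]: "z = 0" by simp
    have "((\<lambda>z. g z - 1) \<longlongrightarrow> 0) (at 0)"
    proof (rule Lim_null_comparison)
      show "((\<lambda>z::complex. exp (norm z) * norm z) \<longlongrightarrow> 0) (at 0)"
        by (auto intro!: tendsto_eq_intros)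
      show "\<forall>\<^sub>F z in at 0. norm (g z - 1) \<le> exp (norm z) * norm z"
      proof (rule eventually_at_filter[THEN iffD2], rule always_eventually, intro allI impI)
        fix z :: complex assume z: "z \<noteq> 0"
        have "norm (exp z - (\<Sum>i\<le>2. z ^ i / fact i)) \<le> exp (norm z) * (norm z ^ Suc 2) / fact 2"
          by (rule Taylor_exp_field)
        also have "(\<Sum>i\<le>2. z ^ i / fact i) = 1 + z + z\<^sup>2 / 2"
          by (simp add: numeral_2_eq_2)
        finally have *: "norm (exp z - (1 + z + z\<^sup>2 / 2)) \<le> exp (norm z) * norm z ^ 3 / 2"
          by (simp add: eval_nat_numeral)
        have "g z - 1 = 2 / z\<^sup>2 * (exp z - (1 + z + z\<^sup>2 / 2))"
          using z by (simp add: g_def stirling_h_def field_simps)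
        then have "norm (g z - 1) = 2 / norm z ^ 2 * norm (exp z - (1 + z + z\<^sup>2 / 2))"
          by (simp only: norm_mult norm_divide norm_power norm_numeral)
        also have "\<dots> \<le> 2 / norm z ^ 2 * (exp (norm z) * norm z ^ 3 / 2)"
          using * by (intro mult_left_mono) auto
        also have "\<dots> = exp (norm z) * norm z"
          using z by (simp add: field_simps eval_nat_numeral)
        finally show "norm (g z - 1) \<le> exp (norm z) * norm z" .
      qed
    qed
    then have "(g \<longlongrightarrow> 1) (at 0)" by (simp add: LIM_zero_iff)
    moreover have "g z = 1" by (simp add: g_def)
    ultimately show "(g \<longlongrightarrow> g z) (at z within S)"
      by (auto intro: tendsto_within_subset)
  qed (use opS in auto)
  moreover have "g z \<noteq> 0" if "z \<in> S" for z
  proof (cases "z = 0")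
    case False
    have "stirling_h z \<noteq> 0"
    proof
      assume h0: "stirling_h z = 0"
      then have "Im z = 0" using stirling_h_zero_real[of z 0] that by (auto simp: S_def)
      then have zr: "z = of_real (Re z)" by (simp add: complex_eq_iff)
      with False have "Re z \<noteq> 0" by auto
      have "stirling_h z = of_real (exp (Re z) - Re z - 1)"
        by (subst zr) (simp add: stirling_h_def exp_of_real)
      with h0 stirling_h_real_pos[OF \<open>Re z \<noteq> 0\<close>] show False
        by (metis less_irrefl of_real_eq_0_iff)
    qed
    with False show ?thesis by (simp add: g_def)
  qed (simp add: g_def)
  ultimately obtain G where holG: "G holomorphic_on S" and G: "\<And>z. z \<in> S \<Longrightarrow> g z = G z ^ 2"
    using contractible_imp_holomorphic_sqrt[OF _ convex_imp_contractible[OF cvS], of g] by metis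
  have Gnz: "G z \<noteq> 0" if "z \<in> S" for z using G \<open>\<And>z. z \<in> S \<Longrightarrow> g z \<noteq> 0\<close> that by force
  have RS: "of_real t \<in> S" for t by (simp add: S_def)
  define k where "k = (\<lambda>t::real. Re (g (of_real t)))"
  have g_real: "g (of_real t) = of_real (if t = 0 then 1 else 2 * (exp t - t - 1) / t\<^sup>2)" for t
    by (simp add: g_def stirling_h_def exp_of_real)
  have k: "k t = (if t = 0 then 1 else 2 * (exp t - t - 1) / t\<^sup>2)" for t
    unfolding k_def g_real by (rule Re_complex_of_real)
  have gk: "g (of_real t) = of_real (k t)" for t
    unfolding k g_real ..
  have kpos: "k t > 0" for t
    using stirling_h_real_pos[of t] by (auto simp: k)
  have phi: "stirling_phi t = 1 / sqrt (k t)" for t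
    by (simp add: stirling_phi_def k real_sqrt_divide field_simps)
  have contG: "continuous_on UNIV (\<lambda>t::real. G (of_real t))"
    by (rule continuous_on_compose2[OF holomorphic_on_imp_continuous_on[OF holG]])
       (auto intro!: continuous_intros simp: RS)
  have contk: "continuous_on UNIV k"
  proof -
    have "k = (\<lambda>t. Re (G (of_real t) ^ 2))" by (simp add: fun_eq_iff k_def G RS)
    then show ?thesis using contG by (auto intro!: continuous_intros)
  qed
  define q where "q = (\<lambda>t::real. G (of_real t) / of_real (sqrt (k t)))"
  have q2: "q t ^ 2 = 1" for t
    using G[OF RS, of t] kpos[of t] Gnz[OF RS, of t]
    by (simp add: q_def power_divide gk flip: of_real_power)
  have "continuous_on UNIV q" unfolding q_def
    using contG contk kpos by (auto intro!: continuous_intros simp: less_imp_neq[symmetric])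
  moreover have "finite (range q)"
    by (rule finite_subset[of _ "{1,-1}"]) (use q2 power2_eq_1_iff in auto)
  ultimately have "q constant_on UNIV"
    using continuous_finite_range_constant connected_UNIV by blast
  then obtain c where c: "\<And>t. q t = c" unfolding constant_on_def by blast
  have "c\<^sup>2 = 1" using q2 c by metis
  show thesis
  proof
    show "(\<lambda>z. c / G z) holomorphic_on {z. \<bar>Im z\<bar> < 2 * pi}"
      using holG Gnz unfolding S_def by (intro holomorphic_intros) auto
    fix t :: real
    have "G (of_real t) = c * of_real (sqrt (k t))"
      using c[of t] kpos[of t] by (simp add: q_def field_simps)
    then show "c / G (of_real t) = of_real (stirling_phi t)"
      using \<open>c\<^sup>2 = 1\<close> by (auto simp: phi)
  qed
qed

text \<open>Contours as in \<^term>\<open>stirling_contour\<close> exist for every \<open>u > 0\<close>.\<close>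

lemma stirling_contour_exists:
  assumes "u > 0"
  shows "\<exists>\<Phi> C. stirling_contour u \<Phi> C \<and> path_image C \<subseteq> {z. \<bar>Im z\<bar> < 2 * pi}"
proof -
  obtain a b :: real where ab: "a < 0" "0 < b"
    "\<And>t. exp t - t - 1 = u \<longleftrightarrow> t = a \<or> t = b"
    using stirling_h_real_zeros[OF assms] by metis
  obtain \<Phi> where \<Phi>: "\<Phi> holomorphic_on {z. \<bar>Im z\<bar> < 2 * pi}"
    "\<And>t::real. \<Phi> (of_real t) = of_real (stirling_phi t)"
    using stirling_phi_extends by blast
  define p q where "p = Complex (a - 1) (-1)" and "q = Complex (b + 1) 1"
  have pq: "Re p < Re q" "Im p < Im q" using ab by (auto simp: p_def q_def)
  define C where "C = rectpath p q"
  have img: "path_image C = cbox p q - box p q"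
    unfolding C_def using pq by (intro path_image_rectpath_cbox_minus_box) auto
  have "frontier (cbox p q) = path_image C"
    by (simp add: img frontier_cbox)
  then have ins: "inside (path_image C) = box p q"
    using inside_frontier_eq_interior[of "cbox p q"] by (simp add: interior_cbox)
  have un: "path_image C \<union> inside (path_image C) = cbox p q"
    by (subst ins, subst img) (use box_subset_cbox[of p q] in auto)
  have strip: "cbox p q \<subseteq> {z. \<bar>Im z\<bar> < 2 * pi}"
    using pi_gt3 by (auto simp: in_cbox_complex_iff p_def q_def abs_if)
  have zeros: "{z \<in> cbox p q. stirling_h z - of_real u = 0} = {of_real a, of_real b}" (is "?L = ?R")
  proof
    show "?L \<subseteq> ?R"
    proof
      fix z assume z: "z \<in> ?L"
      then have "Im z = 0" using stirling_h_zero_real[of z u] strip assms by auto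
      then have zr: "z = of_real (Re z)" by (simp add: complex_eq_iff)
      have "stirling_h z = of_real (exp (Re z) - Re z - 1)"
        by (subst zr) (simp add: stirling_h_def exp_of_real)
      with z have "exp (Re z) - Re z - 1 = u" by (metis (mono_tags, lifting) eq_iff_diff_eq_0 mem_Collect_eq of_real_eq_iff)
      then show "z \<in> ?R" using ab(3) zr by (metis insertCI)
    qed
    have h: "stirling_h (of_real t) = of_real (exp t - t - 1)" for t
      by (simp add: stirling_h_def exp_of_real)
    have "exp a - a - 1 = u" "exp b - b - 1 = u" using ab(3) by blast+
    then have "stirling_h (of_real a) = of_real u" "stirling_h (of_real b) = of_real u"
      unfolding h by simp_all
    then show "?R \<subseteq> ?L"
      using ab(1,2) by (auto simp: in_cbox_complex_iff p_def q_def)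
  qed
  have opn: "open {z. \<bar>Im z\<bar> < 2 * pi}"
    by (intro open_Collect_less continuous_intros)
  have "\<real> \<union> cbox p q \<subseteq> {z. \<bar>Im z\<bar> < 2 * pi}"
    using strip by (auto elim!: Reals_cases)
  then have an: "\<Phi> analytic_on (\<real> \<union> cbox p q)"
    using analytic_on_subset[OF iffD2[OF analytic_on_open[OF opn] \<Phi>(1)]] by blast
  have "stirling_contour u \<Phi> C"
    unfolding stirling_contour_def Un_assoc un unfolding ins
  proof (intro conjI ballI)
    show "\<exists>a b :: real. a < 0 \<and> 0 < b \<and> of_real a \<in> box p q \<and> of_real b \<in> box p q \<and>
        {z \<in> cbox p q. stirling_h z - of_real u = 0} = {of_real a, of_real b}"
      using ab zeros by (intro exI[of _ a] exI[of _ b]) (auto simp: in_box_complex_iff p_def q_def)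
    show "0 \<in> box p q" using ab by (auto simp: in_box_complex_iff p_def q_def)
  qed (use pq \<Phi>(2) an in \<open>auto simp: C_def winding_number_rectpath\<close>)
  then show ?thesis using un strip by blast
qed

end

theory Submission
  imports Defs
begin

text \<open>
  Substituting \<open>t = x e\<^sup>s\<close> in Euler's integral and applying the layer-cake formula to
  \<open>\<integral> e\<^sup>-\<^sup>x\<^sup>h\<^sup>(\<^sup>s\<^sup>) ds\<close> expresses \<open>\<Gamma>\<^sup>*(x)\<close> as \<open>\<surd>(x/2\<pi>) \<integral> e\<^sup>-\<^sup>w L(w/x) dw\<close>, where
  \<open>L(u) = b - a\<close> is the length of \<open>{s. h(s) < u}\<close>. The partial fraction decomposition of
  \<open>h\<^sup>-\<^sup>m/(h - u)\<close> splits the contour integral into the residues at the two real zeros, which give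
  \<open>L(u)\<close>, and residues at \<open>0\<close>, which after an integration by parts along the closed contour give
  the first \<open>m\<close> terms of the expansion of \<open>L(u)\<close> in powers \<open>u\<^sup>j\<^sup>+\<^sup>1\<^sup>/\<^sup>2\<close>. Integrating termwise
  yields the finite expansion with remainder. On the unit circle the kernel is bounded for small
  \<open>u\<close>, so the remainder is \<open>O(x\<^sup>-\<^sup>m)\<close>, and uniqueness of asymptotic expansions identifies the
  coefficients.
\<close>

subsection \<open>The kernel by residues\<close>


text \<open>Taken as a measure instead of as the difference of the two zeros: this makes sense for
  every \<open>u\<close> and fits the layer-cake argument. \<open>stirling_width_eq\<close> recovers
  \<open>b - a\<close>.\<close>

definition stirling_width :: "real \<Rightarrow> real" where
  "stirling_width u = measure lborel {t. exp t - t - 1 < u}"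

definition phi_power_deriv :: "nat \<Rightarrow> real" where
  "phi_power_deriv j = (deriv ^^ (2 * j)) (\<lambda>t. stirling_phi t ^ (2 * j + 1)) 0"

text \<open>The coefficient of \<open>u\<^sup>j\<^sup>+\<^sup>1\<^sup>/\<^sup>2\<close> in the expansion of \<^term>\<open>stirling_width\<close> at \<open>0\<close>.\<close>

definition width_coeff :: "nat \<Rightarrow> real" where
  "width_coeff j = sqrt 2 * 2 ^ j * phi_power_deriv j / (fact (2 * j) * (real j + 1/2))"

lemma stirling_h_of_real: "stirling_h (of_real t) = of_real (exp t - t - 1)"
  by (simp add: stirling_h_def exp_of_real)

lemma stirling_h_has_field_derivative [derivative_intros]:
  "(f has_field_derivative f') (at z within A) \<Longrightarrow>
     ((\<lambda>z. stirling_h (f z)) has_field_derivative (exp (f z) - 1) * f') (at z within A)"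
  unfolding stirling_h_def by (auto intro!: derivative_eq_intros simp: algebra_simps)

lemma deriv_stirling_h: "deriv stirling_h z = exp z - 1"
  by (rule DERIV_imp_deriv) (auto intro!: derivative_eq_intros)

lemma stirling_h_holomorphic [holomorphic_intros]: "stirling_h holomorphic_on A"
  unfolding stirling_h_def by (intro holomorphic_intros)

section \<open>Monotonicity of \<open>exp t - t - 1\<close> and its sublevel intervals\<close>

lemma exp_minus_id_strict_decreasing:
  fixes s t :: real
  assumes "s < t" "t \<le> 0"
  shows "exp t - t - 1 < exp s - s - 1"
proof (rule DERIV_neg_imp_decreasing_open[OF \<open>s < t\<close>])
  fix r assume "s < r" "r < t"
  moreover have "((\<lambda>t. exp t - t - 1) has_real_derivative exp r - 1) (at r)"
    by (auto intro!: derivative_eq_intros)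
  ultimately show "\<exists>y. ((\<lambda>t. exp t - t - 1) has_real_derivative y) (at r) \<and> y < 0"
    using assms by auto
qed (intro continuous_intros)

lemma exp_minus_id_strict_increasing:
  fixes s t :: real
  assumes "s < t" "0 \<le> s"
  shows "exp s - s - 1 < exp t - t - 1"
proof (rule DERIV_pos_imp_increasing_open[OF \<open>s < t\<close>])
  fix r assume "s < r" "r < t"
  moreover have "((\<lambda>t. exp t - t - 1) has_real_derivative exp r - 1) (at r)"
    by (auto intro!: derivative_eq_intros)
  ultimately show "\<exists>y. ((\<lambda>t. exp t - t - 1) has_real_derivative y) (at r) \<and> y > 0"
    using assms by auto
qed (intro continuous_intros)

lemma sublevel_set_eq:
  fixes a b u :: real
  assumes "a < 0" "0 < b" "exp a - a - 1 = u" "exp b - b - 1 = u"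
  shows "{t. exp t - t - 1 < u} = {a<..<b}"
proof (intro set_eqI)
  fix t :: real
  show "t \<in> {t. exp t - t - 1 < u} \<longleftrightarrow> t \<in> {a<..<b}"
    using exp_minus_id_strict_increasing[of t b] exp_minus_id_strict_increasing[of b t]
      exp_minus_id_strict_decreasing[of t a] exp_minus_id_strict_decreasing[of a t] assms
    by (cases "t \<le> 0"; cases "t = a"; cases "t = b") force+
qed

lemma stirling_width_eq:
  assumes "a < 0" "0 < b" "exp a - a - 1 = u" "exp b - b - 1 = u"
  shows "stirling_width u = b - a"
  unfolding stirling_width_def sublevel_set_eq[OF assms] using assms by simp

text \<open>Restricting a complex derivative to the real axis gives the derivative of a real-valued
  curve, so its imaginary part vanishes; induct on \<open>k\<close>. It turns the complex
  derivatives of \<open>\<Phi>\<close> arising from residues at 0 into the real ones in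
  \<open>phi_power_deriv\<close>.\<close>

lemma higher_deriv_real:
  fixes F :: "complex \<Rightarrow> complex" and f :: "real \<Rightarrow> real"
  assumes "F holomorphic_on S" "open S" "\<real> \<subseteq> S" "\<And>t. F (of_real t) = of_real (f t)"
  shows "(deriv ^^ k) F (of_real t) = of_real ((deriv ^^ k) f t)"
proof (induction k arbitrary: t)
  case 0
  then show ?case using assms by simp
next
  case (Suc k)
  let ?G = "(deriv ^^ k) F" and ?g = "(deriv ^^ k) f"
  have "of_real t \<in> S" using assms(3) by auto
  then have D: "(?G has_field_derivative deriv ?G (of_real t)) (at (of_real t))"
    using assms by (intro holomorphic_derivI[of _ S] holomorphic_higher_deriv) auto
  have vd: "((?G \<circ> of_real) has_vector_derivative 1 * deriv ?G (of_real t)) (at t)"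
    by (rule field_vector_diff_chain_at) (use D in \<open>auto intro!: derivative_eq_intros\<close>)
  have "?G \<circ> of_real = (\<lambda>t. of_real (?g t))" using Suc by auto
  with vd have vd: "((\<lambda>t. of_real (?g t)) has_vector_derivative deriv ?G (of_real t)) (at t)" by simp
  have re: "(?g has_vector_derivative Re (deriv ?G (of_real t))) (at t)"
    using bounded_linear.has_vector_derivative[OF bounded_linear_Re vd] by simp
  have "((\<lambda>t. 0) has_vector_derivative Im (deriv ?G (of_real t))) (at t)"
    using bounded_linear.has_vector_derivative[OF bounded_linear_Im vd] by simp
  then have "Im (deriv ?G (of_real t)) = 0"
    using has_vector_derivative_const vector_derivative_at by metis
  moreover have "deriv ?g t = Re (deriv ?G (of_real t))"
    using re by (intro DERIV_imp_deriv) (simp add: has_real_derivative_iff_has_vector_derivative)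
  ultimately show ?case by (simp add: complex_eq_iff)
qed

section \<open>A domain around the contour and the residue theorem on it\<close>

text \<open>The contour hypothesis describes \<open>h - u\<close> on a closed region only, while the
  residue theorem needs an open connected set. The relation between \<open>\<Phi>\<close> and
  \<open>h\<close> is known on the real axis and spreads by the identity theorem.\<close>

lemma stirling_contour_domain:
  assumes C: "stirling_contour u \<Phi> C" and "u > 0"
  obtains S a b where "open S" "connected S" "path_image C \<union> inside (path_image C) \<subseteq> S"
    "\<Phi> holomorphic_on S" "\<forall>z\<in>S. (\<Phi> z)\<^sup>2 * (2 * stirling_h z) = z\<^sup>2"
    "a < 0" "0 < b" "of_real a \<in> inside (path_image C)" "of_real b \<in> inside (path_image C)"
    "\<forall>z\<in>S. stirling_h z = of_real u \<longleftrightarrow> z = of_real a \<or> z = of_real b"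
proof -
  define T where "T = path_image C \<union> inside (path_image C)"
  have C1: "simple_path C" "pathfinish C = pathstart C" "0 \<in> inside (path_image C)"
    and an: "\<Phi> analytic_on (\<real> \<union> T)" and re: "\<And>t::real. \<Phi> (of_real t) = of_real (stirling_phi t)"
    using C by (auto simp: stirling_contour_def T_def Un_assoc)
  obtain a b :: real where ab: "a < 0" "0 < b"
      "of_real a \<in> inside (path_image C)" "of_real b \<in> inside (path_image C)"
    and zeros: "{z \<in> T. stirling_h z - of_real u = 0} = {of_real a, of_real b}"
    using C unfolding stirling_contour_def T_def by blast
  from an obtain U where U: "open U" "\<real> \<union> T \<subseteq> U" "\<Phi> holomorphic_on U"
    unfolding analytic_on_holomorphic by blast
  \<comment> \<open>By the Jordan curve theorem, \<open>T\<close> is the closure of the connected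
    set inside \<open>C\<close>.\<close>
  have "connected (inside (path_image C))" "frontier (inside (path_image C)) = path_image C"
    using Jordan_inside_outside[OF C1(1,2)] by auto
  then have conT: "connected T"
    using connected_imp_connected_closure[of "inside (path_image C)"] closure_Un_frontier[of "inside (path_image C)"]
    by (simp add: T_def Un_commute)
  have 0: "0 \<in> T" using C1 by (simp add: T_def)
  \<comment> \<open>\<open>T\<close> and the real axis are connected and both contain 0, so a single
    component of \<open>U\<close> holds them both; the identity theorem can then pass from one to
    the other.\<close>
  define W where "W = connected_component_set U 0"
  have W: "open W" "connected W" "W \<subseteq> U"
    using U by (auto simp: W_def open_connected_component connected_component_subset)
  have TW: "T \<subseteq> W" unfolding W_def
    using U conT 0 by (intro connected_component_maximal) auto
  have "connected (\<real> :: complex set)"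
    by (intro convex_connected) (simp add: convex_Reals)
  then have RW: "\<real> \<subseteq> W" unfolding W_def
    using U by (intro connected_component_maximal) auto
  have holW: "\<Phi> holomorphic_on W" using U W holomorphic_on_subset by blast
  have phi2: "(\<Phi> z)\<^sup>2 * (2 * stirling_h z) - z\<^sup>2 = 0" if "z \<in> W" for z
  proof (rule analytic_continuation[where f = "\<lambda>z. (\<Phi> z)\<^sup>2 * (2 * stirling_h z) - z\<^sup>2"
          and U = \<real> and S = W and \<xi> = 0])
    show "(\<lambda>z. (\<Phi> z)\<^sup>2 * (2 * stirling_h z) - z\<^sup>2) holomorphic_on W"
      by (intro holomorphic_intros holW)
    have "0 islimpt (range (of_real :: real \<Rightarrow> complex))"
    proof (rule islimpt_approachable[THEN iffD2], intro allI impI)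
      fix e :: real assume "e > 0"
      then show "\<exists>x'\<in>range (of_real :: real \<Rightarrow> complex). x' \<noteq> 0 \<and> dist x' 0 < e"
        by (intro bexI[OF _ rangeI[of of_real "e/2"]]) (auto simp: norm_divide)
    qed
    then show "(0::complex) islimpt \<real>" by (simp add: Reals_def)
    fix z :: complex assume "z \<in> \<real>"
    then obtain t where t: "z = of_real t" by (auto elim: Reals_cases)
    show "(\<Phi> z)\<^sup>2 * (2 * stirling_h z) - z\<^sup>2 = 0"
    proof (cases "t = 0")
      case False
      then have "stirling_phi t ^ 2 * (2 * (exp t - t - 1)) = t\<^sup>2"
        using stirling_h_real_pos[OF False] by (simp add: stirling_phi_def)
      then have "complex_of_real (stirling_phi t ^ 2 * (2 * (exp t - t - 1))) = of_real (t\<^sup>2)"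
        by simp
      then show ?thesis unfolding t re stirling_h_of_real by simp
    qed (simp add: t stirling_h_def)
  qed (use W RW that in auto)
  \<comment> \<open>Zeros of \<open>h - u\<close> are isolated because this entire function takes
    the value \<open>-u\<close>, which is nonzero, at 0.\<close>
  have hz: "\<exists>r>0. \<forall>z\<in>ball c r - {c}. stirling_h z - of_real u \<noteq> 0"
    if hc: "stirling_h c = of_real u" for c
  proof -
    obtain r where "0 < r" "\<And>z. z \<in> ball c r - {c} \<Longrightarrow> stirling_h z - of_real u \<noteq> 0"
    proof (rule isolated_zeros[of "\<lambda>z. stirling_h z - of_real u" UNIV c 0])
      show "stirling_h 0 - of_real u \<noteq> 0" using \<open>u > 0\<close> by (simp add: stirling_h_def)
    qed (use hc in \<open>auto intro!: holomorphic_intros\<close>)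
    then show ?thesis by blast
  qed
  have "stirling_h (of_real a) = of_real u" "stirling_h (of_real b) = of_real u"
    using zeros by auto
  from this[THEN hz] obtain ra rb where r: "ra > 0" "rb > 0"
    "\<forall>z\<in>ball (of_real a) ra - {of_real a}. stirling_h z - of_real u \<noteq> 0"
    "\<forall>z\<in>ball (of_real b) rb - {of_real b}. stirling_h z - of_real u \<noteq> 0" by blast
  \<comment> \<open>\<open>h - u\<close> may have further zeros outside \<open>C\<close>; \<open>V\<close> is open and avoids them.\<close>
  define V where "V = {z. stirling_h z \<noteq> of_real u} \<union> ball (of_real a) ra \<union> ball (of_real b) rb"
  have "open {z. stirling_h z \<noteq> of_real u}"
    unfolding stirling_h_def by (intro open_Collect_neq continuous_intros)
  then have opV: "open V" by (auto simp: V_def)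
  have "z = of_real a \<or> z = of_real b" if "z \<in> T" "stirling_h z = of_real u" for z
    using zeros that by auto
  then have TV: "T \<subseteq> V" using r by (fastforce simp: V_def)
  \<comment> \<open>Intersecting with \<open>V\<close> may destroy connectedness; the component of 0
    restores it and still contains \<open>T\<close>.\<close>
  define S where "S = connected_component_set (W \<inter> V) 0"
  have "S \<subseteq> W \<inter> V" unfolding S_def by (rule connected_component_subset)
  moreover have "T \<subseteq> S" unfolding S_def
    using TW TV conT 0 by (intro connected_component_maximal) auto
  moreover have "open S" unfolding S_def using W opV by (intro open_connected_component) auto
  moreover have "connected S" unfolding S_def by blast
  moreover have "stirling_h (of_real a) = of_real u" "stirling_h (of_real b) = of_real u"
    using zeros by auto
  then have "\<forall>z\<in>V. stirling_h z = of_real u \<longleftrightarrow> z = of_real a \<or> z = of_real b"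
    using r(3,4) by (fastforce simp: V_def)
  ultimately show thesis
    using phi2 holW ab holomorphic_on_subset[of \<Phi> W S]
    by (intro that[of S a b]) (auto simp: T_def)
qed

text \<open>All winding numbers at the poles are 1, and every point off \<open>S\<close> lies
  outside \<open>C\<close>, where the winding number is 0.\<close>

lemma stirling_contour_residues:
  assumes C: "stirling_contour u \<Phi> C"
    and S: "open S" "connected S" "path_image C \<union> inside (path_image C) \<subseteq> S"
    and P: "finite P" "P \<subseteq> inside (path_image C)" and f: "f holomorphic_on S - P"
  shows "(f has_contour_integral 2 * pi * \<i> * (\<Sum>p\<in>P. residue f p)) C"
proof -
  have C': "valid_path C" "pathfinish C = pathstart C"
    and wn: "\<And>z. z \<in> inside (path_image C) \<Longrightarrow> winding_number C z = 1"
    using C by (auto simp: stirling_contour_def)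
  have disj: "inside (path_image C) \<inter> path_image C = {}"
    using inside_no_overlap by blast
  have im: "path_image C \<subseteq> S - P" using S P disj by blast
  have "contour_integral C f = 2 * pi * \<i> * (\<Sum>p\<in>P. winding_number C p * residue f p)"
  proof (rule Residue_theorem)
    show "\<forall>z. z \<notin> S \<longrightarrow> winding_number C z = 0"
    proof (intro allI impI)
      fix z assume "z \<notin> S"
      then have "z \<in> outside (path_image C)" using S by (auto simp: outside_inside)
      then show "winding_number C z = 0"
        using C' by (intro winding_number_zero_in_outside) (auto intro: valid_path_imp_path)
    qed
  qed (use S P f C' im in auto)
  also have "(\<Sum>p\<in>P. winding_number C p * residue f p) = (\<Sum>p\<in>P. residue f p)"
    using P wn by (intro sum.cong) auto
  finally have "contour_integral C f = 2 * pi * \<i> * (\<Sum>p\<in>P. residue f p)" .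
  moreover have "f contour_integrable_on C"
    using S P f C' im by (intro contour_integrable_holomorphic_simple[of f "S - P"])
      (auto intro: finite_imp_closed)
  ultimately show ?thesis using has_contour_integral_integral by metis
qed

section \<open>Partial fractions and evaluation of the kernel\<close>

text \<open>Iterates \<open>u / ((h - u) * h) = 1 / (h - u) - 1 / h\<close>. It separates the poles:
  the first term is singular only where \<open>h = u\<close>, the others only where
  \<open>h = 0\<close>.\<close>

lemma partial_fraction_power:
  fixes h u :: "'a::field"
  assumes "h \<noteq> 0" "h \<noteq> u"
  shows "u ^ m / ((h - u) * h ^ m) = 1 / (h - u) - (\<Sum>j<m. u ^ j / h ^ Suc j)"
proof (induction m)
  case (Suc m)
  have "u ^ Suc m / ((h - u) * h ^ Suc m) = u ^ m / ((h - u) * h ^ m) - u ^ m / h ^ Suc m"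
    using assms by (simp add: field_simps)
  with Suc show ?case by simp
qed simp

text \<open>On \<open>C\<close> the integrand is \<open>sqrt 2 / u ^ m\<close> times
  \<open>f1\<close> minus the sum of \<open>u ^ j * g j\<close>. The poles of \<open>f1\<close>
  inside \<open>C\<close> are \<open>a\<close> and \<open>b\<close>, which yield the width; each
  \<open>g j\<close> is singular inside \<open>C\<close> only at 0 and yields
  \<open>width_coeff j\<close>.\<close>

lemma stirling_kernel_eq:
  assumes C: "stirling_contour u \<Phi> C" and "u > 0"
  shows "stirling_kernel \<Phi> C m u =
    of_real ((stirling_width u - (\<Sum>j<m. width_coeff j * (u ^ j * sqrt u))) / (u ^ m * sqrt u))"
proof -
  obtain S a b where S: "open S" "connected S" "path_image C \<union> inside (path_image C) \<subseteq> S"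
    and hol: "\<Phi> holomorphic_on S" and phi2': "\<forall>z\<in>S. (\<Phi> z)\<^sup>2 * (2 * stirling_h z) = z\<^sup>2"
    and ab: "a < 0" "0 < b" "of_real a \<in> inside (path_image C)" "of_real b \<in> inside (path_image C)"
    and zeros': "\<forall>z\<in>S. stirling_h z = of_real u \<longleftrightarrow> z = of_real a \<or> z = of_real b"
    by (rule stirling_contour_domain[OF assms]) blast
  note phi2 = bspec[OF phi2'] and zeros = bspec[OF zeros']
  have re: "\<And>t::real. \<Phi> (of_real t) = of_real (stirling_phi t)"
    and C': "valid_path C" "pathfinish C = pathstart C" and 0: "0 \<in> inside (path_image C)"
    using C by (auto simp: stirling_contour_def)
  have disj: "inside (path_image C) \<inter> path_image C = {}" using inside_no_overlap by blast
  have S0: "0 \<in> S" "of_real a \<in> S" "of_real b \<in> S" using S ab 0 by auto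
  have inS: "z \<in> S" "z \<noteq> 0" "stirling_h z \<noteq> of_real u" if "z \<in> path_image C" for z
  proof -
    have "z \<notin> inside (path_image C)" using disj that by blast
    then show "z \<in> S" "z \<noteq> 0" "stirling_h z \<noteq> of_real u"
      using S zeros[of z] ab 0 that by auto
  qed
  have nz: "\<Phi> z \<noteq> 0 \<and> stirling_h z \<noteq> 0" if "z \<in> S" "z \<noteq> 0" for z
    using phi2[OF that(1)] that by auto
  \<comment> \<open>Up to the factor \<open>sqrt 2\<close>, \<open>q\<close> is the reciprocal of
    the chosen square root of \<open>h\<close>. Using only \<open>q ^ 2 = 1 / (2 * h)\<close> avoids
    any further choice of branch.\<close>
  define q where "q = (\<lambda>z. \<Phi> z / z)"
  have q2: "q z ^ 2 = 1 / (2 * stirling_h z)" if "z \<in> S" "z \<noteq> 0" for z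
    using phi2[OF that(1)] nz[OF that] that by (simp add: q_def power_divide field_simps)
  have holq: "q holomorphic_on S - {0}"
    unfolding q_def by (intro holomorphic_intros holomorphic_on_subset[OF hol]) auto
  have opS0: "open (S - {0})" using S by auto
  \<comment> \<open>Differentiate \<open>q ^ 2 = 1 / (2 * h)\<close> and cancel
    \<open>2 * q\<close>, which does not vanish.\<close>
  have dq: "(q has_field_derivative - (exp z - 1) * q z ^ 3) (at z)" if z: "z \<in> S" "z \<noteq> 0" for z
  proof -
    obtain d where d: "(q has_field_derivative d) (at z)"
      using holomorphic_derivI[OF holq opS0, of z] z by auto
    have "((\<lambda>z. q z ^ 2) has_field_derivative 2 * q z * d) (at z)"
      by (rule derivative_eq_intros d refl)+ simp
    then have "((\<lambda>z. 1 / (2 * stirling_h z)) has_field_derivative 2 * q z * d) (at z)"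
      by (rule has_field_derivative_transform_within_open[OF _ opS0]) (use q2 z in auto)
    moreover have "((\<lambda>z. 1 / (2 * stirling_h z)) has_field_derivative
        - (exp z - 1) / (2 * stirling_h z ^ 2)) (at z)"
      using nz[OF z] by (auto intro!: derivative_eq_intros simp: field_simps power2_eq_square)
    ultimately have "2 * q z * d = - (exp z - 1) / (2 * stirling_h z ^ 2)"
      by (rule DERIV_unique)
    also have "\<dots> = - 2 * (exp z - 1) * (q z ^ 2) ^ 2"
      unfolding q2[OF z] using nz[OF z] by (simp add: field_simps power2_eq_square)
    finally have "2 * q z * d = 2 * q z * (- (exp z - 1) * q z ^ 3)"
      by (simp add: eval_nat_numeral algebra_simps)
    moreover have "q z \<noteq> 0" using nz[OF z] z by (simp add: q_def)
    ultimately have "d = - (exp z - 1) * q z ^ 3" by (metis mult_cancel_left mult_eq_0_iff zero_neq_numeral)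
    with d show ?thesis by simp
  qed
  define f1 where "f1 = (\<lambda>z. (exp z - 1) * \<Phi> z / (stirling_h z - of_real u))"
  have real_zero: "exp t - t - 1 = u" if "t = a \<or> t = b" for t
    using zeros[of "of_real t"] that S0 by (auto simp: stirling_h_of_real simp flip: of_real_add of_real_diff)
  have f1: "(f1 has_contour_integral 2 * pi * \<i> * ((b - a) / sqrt (2 * u))) C"
  proof -
    let ?P = "{complex_of_real a, of_real b}"
    have "(f1 has_contour_integral 2 * pi * \<i> * (\<Sum>p\<in>?P. residue f1 p)) C"
      using ab zeros unfolding f1_def
      by (intro stirling_contour_residues[OF C S] holomorphic_intros holomorphic_on_subset[OF hol]) auto
    also have "(\<Sum>p\<in>?P. residue f1 p) = residue f1 (of_real a) + residue f1 (of_real b)"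
      using ab by simp
    finally have sum: "(f1 has_contour_integral 2 * pi * \<i> * (residue f1 (of_real a) + residue f1 (of_real b))) C" .
    \<comment> \<open>At a simple pole the residue is the numerator over the derivative of
      \<open>h - u\<close>. The factor \<open>exp t - 1\<close> cancels and leaves
      \<open>stirling_phi t\<close>. As \<open>a < 0 < b\<close>, the two absolute values add up to
      \<open>b - a\<close>.\<close>
    have "residue f1 (of_real t) = of_real (\<bar>t\<bar> / sqrt (2 * u))" if t: "t = a \<or> t = b" for t
    proof -
      have et: "exp (complex_of_real t) - 1 \<noteq> 0"
        using t ab by (auto simp: exp_of_real)
      have "residue f1 (of_real t) = (exp (of_real t) - 1) * \<Phi> (of_real t) / (exp (of_real t) - 1)"
        unfolding f1_def
      proof (rule residue_simple_pole_deriv[where s = S])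
        show "((\<lambda>z. stirling_h z - of_real u) has_field_derivative exp (complex_of_real t) - 1)
                (at (of_real t))"
          by (auto intro!: derivative_eq_intros)
        show "(exp (of_real t) - 1) * \<Phi> (of_real t) \<noteq> 0"
          using et nz[of "of_real t"] t S0 ab by auto
        show "stirling_h (of_real t) - of_real u = 0" using zeros[of "of_real t"] t S0 by auto
      qed (use S S0 t et in \<open>auto intro!: holomorphic_intros hol\<close>)
      also have "\<dots> = of_real (stirling_phi t)" using et by (simp add: re)
      also have "stirling_phi t = \<bar>t\<bar> / sqrt (2 * u)"
        using t ab real_zero[OF t] by (auto simp: stirling_phi_def real_sqrt_divide real_sqrt_mult)
      finally show ?thesis .
    qed
    from this[of a] this[of b] have "residue f1 (of_real a) + residue f1 (of_real b)
        = of_real ((b - a) / sqrt (2 * u))"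
      using ab by (simp add: diff_divide_distrib)
    with sum show ?thesis by simp
  qed
  define g where "g = (\<lambda>j z. (exp z - 1) * \<Phi> z / stirling_h z ^ Suc j)"
  have g: "(g j has_contour_integral 2 * pi * \<i> * (width_coeff j / sqrt 2)) C" for j
  proof -
    \<comment> \<open>As \<open>q' = - h' q\<^sup>3\<close>, the derivative of \<open>z q\<^sup>2\<^sup>j\<^sup>+\<^sup>1\<close> differs from \<open>q\<^sup>2\<^sup>j\<^sup>+\<^sup>1\<close> by a multiple of \<open>g j\<close>,
      and the former integrates to \<open>0\<close> along \<open>C\<close>.\<close>
    define P where "P = (\<lambda>z. z * q z ^ (2 * j + 1))"
    define N where "N = (of_nat (2 * j + 1) :: complex)"
    have N: "N \<noteq> 0" unfolding N_def by (metis of_nat_eq_0_iff add_is_0 one_neq_zero)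
    define P' where "P' = (\<lambda>z. q z ^ (2 * j + 1) - N * z * (exp z - 1) * q z ^ (2 * j + 3))"
    have "(P' has_contour_integral 0) C"
    proof (rule Cauchy_theorem_primitive[where S = "S - {0}"])
      fix z assume z: "z \<in> S - {0}"
      have "((\<lambda>z. q z ^ (2 * j + 1)) has_field_derivative
          N * (- (exp z - 1) * q z ^ 3 * q z ^ (2 * j))) (at z)"
        using DERIV_power[OF dq, of z "2 * j + 1"] z by (simp add: N_def)
      from DERIV_mult[OF DERIV_ident this] have "(P has_field_derivative P' z) (at z)"
        unfolding P_def
        by (rule DERIV_cong) (simp add: P'_def power_add algebra_simps)
      then show "(P has_field_derivative P' z) (at z within S - {0})"
        by (rule has_field_derivative_at_within)
    qed (use C' inS in auto)
    moreover have "((\<lambda>z. q z ^ (2 * j + 1)) has_contour_integral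
        2 * pi * \<i> * (phi_power_deriv j / fact (2 * j))) C"
    proof -
      \<comment> \<open>The denominator has exponent \<open>2 * j + 1\<close>, so the residue is the
        Taylor coefficient of index \<open>2 * j\<close> of the numerator.\<close>
      let ?f = "\<lambda>z. \<Phi> z ^ (2 * j + 1) / z ^ Suc (2 * j)"
      have eq: "(\<lambda>z. q z ^ (2 * j + 1)) = ?f" by (simp add: q_def power_divide)
      have "((\<lambda>z. q z ^ (2 * j + 1)) has_contour_integral 2 * pi * \<i> *
               (\<Sum>p\<in>{0}. residue (\<lambda>z. q z ^ (2 * j + 1)) p)) C"
        using 0 by (intro stirling_contour_residues[OF C S] holomorphic_intros holq) auto
      also have "(\<Sum>p\<in>{0}. residue (\<lambda>z. q z ^ (2 * j + 1)) p) =
          (deriv ^^ (2 * j)) (\<lambda>z. \<Phi> z ^ (2 * j + 1)) 0 / fact (2 * j)"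
        unfolding eq using residue_holomorphic_over_power'[of S "\<lambda>z. \<Phi> z ^ (2 * j + 1)" "2 * j"]
        by (simp add: S S0 hol holomorphic_intros)
      also have "(deriv ^^ (2 * j)) (\<lambda>z. \<Phi> z ^ (2 * j + 1)) 0 = of_real (phi_power_deriv j)"
      proof -
        \<comment> \<open>\<open>higher_deriv_real\<close> asks for an open set containing the real
          axis; the contour hypothesis supplies one.\<close>
        have "\<Phi> analytic_on (\<real> \<union> path_image C \<union> inside (path_image C))"
          using C by (simp add: stirling_contour_def)
        then obtain U where U: "open U" "\<real> \<subseteq> U" "\<Phi> holomorphic_on U"
          unfolding analytic_on_holomorphic by blast
        have "(deriv ^^ (2 * j)) (\<lambda>z. \<Phi> z ^ (2 * j + 1)) (of_real 0) = of_real (phi_power_deriv j)"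
          unfolding phi_power_deriv_def
          by (rule higher_deriv_real[of _ U]) (use U re in \<open>auto intro!: holomorphic_intros\<close>)
        then show ?thesis by simp
      qed
      finally show ?thesis by simp
    qed
    \<comment> \<open>\<open>N\<close> cancels the factor from the power rule, and
      \<open>2 ^ Suc j\<close> cancels the twos in \<open>(1 / (2 * h)) ^ Suc j\<close>.\<close>
    ultimately have "((\<lambda>z. 2 ^ Suc j / N * (q z ^ (2 * j + 1) - P' z)) has_contour_integral
        2 ^ Suc j / N * (2 * pi * \<i> * (phi_power_deriv j / fact (2 * j)) - 0)) C"
      by (intro has_contour_integral_lmul has_contour_integral_diff)
    moreover have "2 ^ Suc j / N * (q z ^ (2 * j + 1) - P' z) = g j z"
      if "z \<in> path_image C" for z
    proof -
      note z = inS[OF that]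
      have "2 ^ Suc j / N * (q z ^ (2 * j + 1) - P' z)
          = 2 ^ Suc j * (z * (exp z - 1) * q z ^ (2 * j + 3))"
        using N by (simp add: P'_def)
      also have "q z ^ (2 * j + 3) = q z * (q z ^ 2) ^ Suc j"
        by (simp add: power_add eval_nat_numeral power_mult mult.commute flip: power_mult_distrib)
      also have "\<dots> = \<Phi> z / z * (1 / (2 * stirling_h z)) ^ Suc j"
        by (simp only: q2[OF z(1,2)]) (simp add: q_def)
      finally show ?thesis
        using z nz[of z] by (simp add: g_def power_divide power_mult_distrib)
    qed
    moreover have "2 ^ Suc j / N * (2 * pi * \<i> * (phi_power_deriv j / fact (2 * j)) - 0)
        = 2 * pi * \<i> * complex_of_real (width_coeff j / sqrt 2)"
    proof -
      have eq: "2 ^ Suc j / (2 * real j + 1) * (phi_power_deriv j / fact (2 * j)) = width_coeff j / sqrt 2"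
      proof -
        have e: "real j + 1/2 = (2 * real j + 1) / 2" by simp
        show ?thesis unfolding width_coeff_def e by (simp add: mult_ac)
      qed
      have A: "2 ^ Suc j / N = of_real (2 ^ Suc j / (2 * real j + 1))"
        by (simp add: N_def add.commute)
      have "2 ^ Suc j / N * (2 * pi * \<i> * (phi_power_deriv j / fact (2 * j)) - 0)
          = 2 * pi * \<i> * (2 ^ Suc j / N * (phi_power_deriv j / fact (2 * j)))"
        by simp
      also have "2 ^ Suc j / N * (phi_power_deriv j / fact (2 * j)) = of_real (width_coeff j / sqrt 2)"
        unfolding A eq[symmetric] by simp
      finally show ?thesis .
    qed
    ultimately show ?thesis by (metis (no_types, lifting) has_contour_integral_eq)
  qed
  define I where "I = (\<lambda>z. z * deriv stirling_h z / (stirling_h z - of_real u)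
                              * stirling_h_sqrt \<Phi> z powi (- 2 * int m - 1))"
  have "((\<lambda>z. sqrt 2 / u ^ m * (f1 z - (\<Sum>j<m. u ^ j * g j z))) has_contour_integral
     sqrt 2 / u ^ m * (2 * pi * \<i> * ((b - a) / sqrt (2 * u)) -
         (\<Sum>j<m. u ^ j * (2 * pi * \<i> * (width_coeff j / sqrt 2))))) C"
    by (intro has_contour_integral_lmul has_contour_integral_diff has_contour_integral_sum f1 g) auto
  moreover have "sqrt 2 / u ^ m * (f1 z - (\<Sum>j<m. u ^ j * g j z)) = I z" if "z \<in> path_image C" for z
  proof -
    note z = inS[OF that]
    have s2: "complex_of_real (sqrt 2) ^ 2 = 2" by (simp flip: of_real_power)
    have pw: "w powi (- 2 * int m - 1) = inverse w ^ (2 * m + 1)" for w :: complex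
    proof -
      have "- 2 * int m - 1 = - int (2 * m + 1)" by simp
      then show ?thesis by (simp only: power_int_minus power_int_of_nat power_inverse)
    qed
    \<comment> \<open>Splitting off one factor \<open>sqrt 2 * q\<close> leaves the m-th power of
      \<open>2 * q ^ 2 = 1 / h\<close>.\<close>
    have "stirling_h_sqrt \<Phi> z powi (- 2 * int m - 1) = (sqrt 2 * q z) ^ (2 * m + 1)"
      unfolding pw by (simp add: stirling_h_sqrt_def q_def)
    also have "\<dots> = sqrt 2 * q z * (of_real (sqrt 2) ^ 2 * q z ^ 2) ^ m"
      by (simp add: power_mult_distrib power_mult)
    also have "\<dots> = sqrt 2 * q z / stirling_h z ^ m"
      by (simp only: s2 q2[OF z(1,2)]) (simp add: power_divide)
    finally have I: "I z = z * (exp z - 1) / (stirling_h z - of_real u) * (sqrt 2 * q z / stirling_h z ^ m)"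
      by (simp only: I_def deriv_stirling_h)
    have zq: "\<Phi> z = z * q z" using z by (simp add: q_def)
    have "I z = sqrt 2 / u ^ m * ((exp z - 1) * \<Phi> z * (of_real u ^ m / ((stirling_h z - of_real u) * stirling_h z ^ m)))"
      unfolding I zq using \<open>u > 0\<close> by (simp add: mult_ac)
    also have "\<dots> = sqrt 2 / u ^ m * (f1 z - (\<Sum>j<m. u ^ j * g j z))"
      using z nz[of z] by (subst partial_fraction_power)
        (auto simp: f1_def g_def right_diff_distrib diff_divide_distrib sum_distrib_left mult_ac)
    finally show ?thesis by simp
  qed
  ultimately have "contour_integral C I = sqrt 2 / u ^ m * (2 * pi * \<i> * ((b - a) / sqrt (2 * u)) -
         (\<Sum>j<m. u ^ j * (2 * pi * \<i> * (width_coeff j / sqrt 2))))"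
    by (metis (no_types, lifting) has_contour_integral_eq contour_integral_unique)
  also have "(\<Sum>j<m. u ^ j * (2 * pi * \<i> * (width_coeff j / sqrt 2))) =
      2 * pi * \<i> * of_real (\<Sum>j<m. width_coeff j * u ^ j / sqrt 2)"
    by (simp add: sum_distrib_left mult_ac)
  also have "sqrt 2 / u ^ m * (2 * pi * \<i> * ((b - a) / sqrt (2 * u)) -
        2 * pi * \<i> * of_real (\<Sum>j<m. width_coeff j * u ^ j / sqrt 2)) =
      2 * pi * \<i> * of_real (sqrt 2 / u ^ m * ((b - a) / sqrt (2 * u) - (\<Sum>j<m. width_coeff j * u ^ j / sqrt 2)))"
    by (simp add: right_diff_distrib left_diff_distrib diff_divide_distrib mult_ac del: of_real_sum)
  finally have ci: "contour_integral C I = \<dots>" .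
  have k: "stirling_kernel \<Phi> C m u =
      of_real (sqrt 2 / u ^ m * ((b - a) / sqrt (2 * u) - (\<Sum>j<m. width_coeff j * u ^ j / sqrt 2)))"
    unfolding stirling_kernel_def I_def[symmetric] ci by simp
  have "stirling_width u = b - a"
    using stirling_width_eq ab real_zero by blast
  have "sqrt 2 / u ^ m * ((b - a) / sqrt (2 * u) - (\<Sum>j<m. width_coeff j * u ^ j / sqrt 2)) =
      (stirling_width u - (\<Sum>j<m. width_coeff j * (u ^ j * sqrt u))) / (u ^ m * sqrt u)"
  proof -
    define Z where "Z = (\<Sum>j<m. width_coeff j * u ^ j)"
    have "(\<Sum>j<m. width_coeff j * u ^ j / sqrt 2) = Z / sqrt 2"
      by (simp add: Z_def sum_divide_distrib)
    moreover have "(\<Sum>j<m. width_coeff j * (u ^ j * sqrt u)) = Z * sqrt u"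
      by (simp add: Z_def sum_distrib_right mult.assoc)
    ultimately show ?thesis
      using \<open>u > 0\<close> \<open>stirling_width u = b - a\<close>
      by (simp add: real_sqrt_mult right_diff_distrib diff_divide_distrib)
  qed
  with k show ?thesis by (simp only:)
qed

subsection \<open>The width integral\<close>


lemma exp_minus_id_nonneg: "exp t - t - 1 \<ge> (0::real)"
  using exp_ge_add_one_self[of t] by linarith

lemma sublevel_set_measurable [measurable]: "{t::real. exp t - t - 1 < u} \<in> sets borel"
  by measurable

text \<open>On the left \<open>exp t > 0\<close> suffices; on the right the quadratic Taylor bound
  at \<open>u + 2\<close> does, since \<open>(u+2)^2 / 2\<close> is at least \<open>u\<close>. The
  resulting linear bound on the width controls large \<open>u\<close>.\<close>

lemma sublevel_set_subset:
  assumes "u > 0"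
  shows "{t::real. exp t - t - 1 < u} \<subseteq> {-(u+1)..u+2}"
proof
  fix t :: real assume t: "t \<in> {t. exp t - t - 1 < u}"
  have "t \<le> u + 2"
  proof (rule ccontr)
    assume "\<not> t \<le> u + 2"
    then have "exp (u + 2) - (u + 2) - 1 < u"
      using exp_minus_id_strict_increasing[of "u + 2" t] t assms by auto
    moreover have "1 + (u+2) + (u+2)\<^sup>2/2 \<le> exp (u+2)"
      using assms by (intro exp_lower_Taylor_quadratic) auto
    moreover have "(u+2)\<^sup>2/2 \<ge> u" using assms by (simp add: power2_eq_square algebra_simps)
    ultimately show False by simp
  qed
  moreover have "exp t - t - 1 < u" using t by simp
  then have "t \<ge> -(u+1)" using exp_gt_zero[of t] by linarith
  ultimately show "t \<in> {-(u+1)..u+2}" by simp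
qed

lemma emeasure_sublevel_set:
  "u > 0 \<Longrightarrow> emeasure lborel {t. exp t - t - 1 < u} = ennreal (stirling_width u)"
proof -
  assume "u > 0"
  then have "emeasure lborel {t. exp t - t - 1 < u} \<le> emeasure lborel {-(u+1)..u+2}"
    by (intro emeasure_mono sublevel_set_subset) auto
  also have "\<dots> < \<infinity>" by (simp add: emeasure_lborel_Icc_eq)
  finally show ?thesis
    unfolding stirling_width_def by (intro emeasure_eq_ennreal_measure) auto
qed

lemma stirling_width_bounds:
  assumes "u > 0"
  shows "0 \<le> stirling_width u" "stirling_width u \<le> 2 * u + 3"
proof -
  have "stirling_width u \<le> measure lborel {-(u+1)..u+2}"
    unfolding stirling_width_def
    by (intro measure_mono_fmeasurable sublevel_set_subset assms) (auto intro!: fmeasurableI simp: emeasure_lborel_Icc_eq)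
  then show "stirling_width u \<le> 2 * u + 3" using assms by simp
qed (simp add: stirling_width_def)

lemma nn_integral_exp_tail: "(\<integral>\<^sup>+w. indicator {s<..} w * ennreal (exp (- w)) \<partial>lborel) = ennreal (exp (- s))"
proof -
  have "((\<lambda>x. - exp (- x)) \<longlongrightarrow> (0::real)) at_top"
    using tendsto_minus[OF filterlim_compose[OF exp_at_bot filterlim_uminus_at_bot_at_top]] by simp
  then have "(\<integral>\<^sup>+w. ennreal (exp (- w)) * indicator {s..} w \<partial>lborel) = ennreal (0 - (- exp (- s)))"
    by (intro nn_integral_FTC_atLeast) (auto intro!: derivative_eq_intros)
  moreover have "(\<integral>\<^sup>+w. indicator {s<..} w * ennreal (exp (- w)) \<partial>lborel) =
      (\<integral>\<^sup>+w. ennreal (exp (- w)) * indicator {s..} w \<partial>lborel)"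
  proof (rule nn_integral_cong_AE)
    have "AE w in lborel. w \<noteq> s" by (rule AE_lborel_singleton)
    then show "AE w in lborel. indicator {s<..} w * ennreal (exp (- w)) = ennreal (exp (- w)) * indicator {s..} w"
      by eventually_elim (auto simp: indicator_def)
  qed
  ultimately show ?thesis by simp
qed

section \<open>Euler's integral and the layer-cake formula\<close>

text \<open>Under \<open>t = x * exp s\<close> the measure \<open>t powr (x - 1) dt\<close> becomes
  \<open>t powr x ds\<close>, and the integrand is \<open>x powr x * exp (- x)\<close> times
  \<open>exp (- (x * (exp s - s - 1)))\<close>.\<close>

lemma Gamma_exp_integral:
  assumes x: "x > 0"
  shows "(\<integral>\<^sup>+t. ennreal (exp (- (x * (exp t - t - 1)))) \<partial>lborel) = ennreal (Gamma x * exp x / x powr x)"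
proof -
  let ?f = "\<lambda>t::real. t powr (x - 1) / exp t" and ?g = "\<lambda>s::real. x * exp s"
  have G: "?f absolutely_integrable_on {0<..}" "integral {0<..} ?f = Gamma x"
  proof -
    \<comment> \<open>The endpoint 0 is dropped because the substitution maps the whole real axis
      onto the open half-axis.\<close>
    have "(?f has_integral Gamma x) {0<..}"
      by (rule has_integral_spike_set_eq[THEN iffD1, OF _ _ Gamma_integral_real[OF x]])
         (auto intro: negligible_subset[of "{0}"])
    then show "?f absolutely_integrable_on {0<..}" "integral {0<..} ?f = Gamma x"
      by (auto intro!: nonnegative_absolutely_integrable_1 simp: integrable_on_def)
  qed
  have img: "?g ` UNIV = {0<..}"
  proof (intro equalityI subsetI)
    fix y :: real assume "y \<in> {0<..}"
    then show "y \<in> ?g ` UNIV" using x by (intro image_eqI[of _ _ "ln (y / x)"]) auto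
  qed (use x in auto)
  have "(\<lambda>s. \<bar>x * exp s\<bar> * ?f (?g s)) absolutely_integrable_on UNIV \<and>
        integral UNIV (\<lambda>s. \<bar>x * exp s\<bar> * ?f (?g s)) = Gamma x"
  proof -
    have leb: "(UNIV :: real set) \<in> sets lebesgue" by simp
    have d: "(?g has_field_derivative x * exp s) (at s)" for s
      by (auto intro!: derivative_eq_intros)
    have inj: "inj ?g" using x by (auto intro!: injI)
    show ?thesis
      using iffD2[OF has_absolute_integral_change_of_variables_1'[OF leb d inj, of ?f "Gamma x", unfolded img]] G
      by blast
  qed
  then have "((\<lambda>s. \<bar>x * exp s\<bar> * ?f (?g s)) has_integral Gamma x) UNIV"
    using absolutely_integrable_on_def integrable_integral by metis
  moreover have "\<bar>x * exp s\<bar> * ?f (?g s) = x powr x * exp (- x) * exp (- (x * (exp s - s - 1)))" for s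
  proof -
    have "\<bar>x * exp s\<bar> * ?f (?g s) = (x * exp s) powr x / exp (x * exp s)"
      using x by (simp add: powr_diff)
    also have "(x * exp s) powr x = x powr x * exp (x * s)"
      using x by (simp add: powr_mult) (simp add: powr_def)
    finally show ?thesis
      by (simp add: exp_diff right_diff_distrib exp_minus field_simps exp_add)
  qed
  ultimately have "((\<lambda>s. x powr x * exp (- x) * exp (- (x * (exp s - s - 1)))) has_integral Gamma x) UNIV"
    by (simp only:)
  from has_integral_mult_right[OF this, of "exp x / x powr x"]
  have "((\<lambda>s. exp (- (x * (exp s - s - 1)))) has_integral (exp x / x powr x * Gamma x)) UNIV"
    using x by (simp add: exp_minus field_simps)
  then have "(\<integral>\<^sup>+t. ennreal (exp (- (x * (exp t - t - 1)))) \<partial>lborel) = ennreal (exp x / x powr x * Gamma x)"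
    by (intro nn_integral_has_integral_lborel) auto
  then show ?thesis by (simp add: mult.commute)
qed

text \<open>Layer-cake formula: both sides integrate \<open>e\<^sup>-\<^sup>w\<close> over the region \<open>w > x (e\<^sup>t - t - 1)\<close>.\<close>
lemma nn_integral_stirling_width:
  assumes x: "x > 0"
  shows "(\<integral>\<^sup>+w. indicator {0<..} w * ennreal (exp (- w) * stirling_width (w / x)) \<partial>lborel)
           = ennreal (Gamma x * exp x / x powr x)"
proof -
  let ?F = "\<lambda>t w. indicator {x * (exp t - t - 1)<..} w * ennreal (exp (- w))"
  have "(\<integral>\<^sup>+w. indicator {0<..} w * ennreal (exp (- w) * stirling_width (w / x)) \<partial>lborel)
      = (\<integral>\<^sup>+w. (\<integral>\<^sup>+t. ?F t w \<partial>lborel) \<partial>lborel)"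
  proof (rule nn_integral_cong)
    fix w :: real
    show "indicator {0<..} w * ennreal (exp (- w) * stirling_width (w / x)) = (\<integral>\<^sup>+t. ?F t w \<partial>lborel)"
    proof (cases "w > 0")
      case True
      have "(\<integral>\<^sup>+t. ?F t w \<partial>lborel) =
          (\<integral>\<^sup>+t. ennreal (exp (- w)) * indicator {t. exp t - t - 1 < w / x} t \<partial>lborel)"
        using x by (intro nn_integral_cong) (auto simp: indicator_def field_simps)
      also have "\<dots> = ennreal (exp (- w)) * emeasure lborel {t. exp t - t - 1 < w / x}"
        by (subst nn_integral_cmult_indicator) auto
      also have "\<dots> = ennreal (exp (- w) * stirling_width (w / x))"
        using True x by (simp add: emeasure_sublevel_set ennreal_mult')
      finally show ?thesis using True by simp
    next
      case False
      then have "\<not> x * (exp t - t - 1) < w" for t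
        using mult_nonneg_nonneg[OF less_imp_le[OF x] exp_minus_id_nonneg[of t]] by linarith
      then show ?thesis using False by (simp add: indicator_def)
    qed
  qed
  also have "\<dots> = (\<integral>\<^sup>+t. (\<integral>\<^sup>+w. ?F t w \<partial>lborel) \<partial>lborel)"
    by (intro lborel_pair.Fubini') (simp add: indicator_def, measurable)
  also have "\<dots> = ennreal (Gamma x * exp x / x powr x)"
    by (simp add: nn_integral_exp_tail Gamma_exp_integral[OF x])
  finally show ?thesis .
qed

lemma scaled_Gamma_width_integral:
  assumes x: "x > 0"
  shows "set_integrable lborel {0<..} (\<lambda>w. exp (- w) * stirling_width (w / x))"
    and "scaled_Gamma x =
      sqrt (x / (2 * pi)) * (LINT w:{0<..}|lborel. exp (- w) * stirling_width (w / x))"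
proof -
  let ?f = "\<lambda>w. exp (- w) * stirling_width (w / x)"
  \<comment> \<open>The width is the inner integral of a jointly measurable indicator, hence
    measurable in \<open>u\<close>.\<close>
  have [measurable]: "stirling_width \<in> borel_measurable borel"
  proof -
    have "(\<lambda>u. emeasure lborel {t::real. exp t - t - 1 < u}) = (\<lambda>u. \<integral>\<^sup>+t. indicator {t. exp t - t - 1 < u} t \<partial>lborel)"
      by (intro ext) simp
    also have "\<dots> = (\<lambda>u. \<integral>\<^sup>+t. (if exp t - t - 1 < u then 1 else 0) \<partial>lborel)"
      by (intro ext nn_integral_cong) (simp add: indicator_def)
    also have "\<dots> \<in> borel_measurable borel"
      by measurable
    finally show ?thesis
      unfolding stirling_width_def measure_def by measurable
  qed
  have hb: "has_bochner_integral lborel (\<lambda>w. indicator {0<..} w *\<^sub>R ?f w) (Gamma x * exp x / x powr x)"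
  proof (rule has_bochner_integral_nn_integral)
    show "AE w in lborel. 0 \<le> indicator {0<..} w *\<^sub>R ?f w"
      by (auto simp: indicator_def stirling_width_def)
    have "(\<integral>\<^sup>+w. ennreal (indicator {0<..} w *\<^sub>R ?f w) \<partial>lborel)
        = (\<integral>\<^sup>+w. indicator {0<..} w * ennreal (?f w) \<partial>lborel)"
      by (intro nn_integral_cong) (auto simp: indicator_def)
    then show "(\<integral>\<^sup>+w. ennreal (indicator {0<..} w *\<^sub>R ?f w) \<partial>lborel) = ennreal (Gamma x * exp x / x powr x)"
      using nn_integral_stirling_width[OF x] by simp
  qed (use x in \<open>auto intro!: divide_nonneg_nonneg mult_nonneg_nonneg less_imp_le[OF Gamma_real_pos]\<close>)
  then show "set_integrable lborel {0<..} ?f"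
    unfolding set_integrable_def by (rule integrable.intros)
  have "(LINT w:{0<..}|lborel. ?f w) = Gamma x * exp x / x powr x"
    unfolding set_lebesgue_integral_def by (rule has_bochner_integral_integral_eq[OF hb])
  moreover have "scaled_Gamma x = sqrt (x / (2 * pi)) * (Gamma x * exp x / x powr x)"
  proof -
    have "x powr (x - 1/2) = x powr x / sqrt x"
      using x by (simp add: powr_diff powr_half_sqrt)
    then show ?thesis using x
      by (simp add: scaled_Gamma_def real_sqrt_divide exp_minus field_simps)
  qed
  ultimately show "scaled_Gamma x = sqrt (x / (2 * pi)) * (LINT w:{0<..}|lborel. ?f w)"
    by simp
qed

text \<open>Euler's integral at \<open>j + 3/2\<close>; it integrates the terms
  \<open>u ^ j * sqrt u\<close> of the width expansion.\<close>

lemma Gamma_half_integral: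
  "set_integrable lborel {0<..} (\<lambda>w. exp (- w) * w powr (real j + 1/2))"
  "(LINT w:{0<..}|lborel. exp (- w) * w powr (real j + 1/2)) = Gamma (real j + 3/2)"
proof -
  let ?f = "\<lambda>w. exp (- w) * w powr (real j + 1/2)"
  have "((\<lambda>t. t powr (real j + 3/2 - 1) / exp t) has_integral Gamma (real j + 3/2)) {0..}"
    by (rule Gamma_integral_real) simp
  then have "(?f has_integral Gamma (real j + 3/2)) {0..}"
    by (simp add: exp_minus field_simps)
  from nn_integral_has_integral_lebesgue[OF _ this]
  have nn: "(\<integral>\<^sup>+w. ennreal (indicator {0..} w * ?f w) \<partial>lborel) = ennreal (Gamma (real j + 3/2))"
    by simp
  have hb: "has_bochner_integral lborel (\<lambda>w. indicator {0<..} w *\<^sub>R ?f w) (Gamma (real j + 3/2))"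
  proof (rule has_bochner_integral_nn_integral)
    have "(\<integral>\<^sup>+w. ennreal (indicator {0<..} w *\<^sub>R ?f w) \<partial>lborel)
        = (\<integral>\<^sup>+w. ennreal (indicator {0..} w * ?f w) \<partial>lborel)"
      by (intro nn_integral_cong) (auto simp: indicator_def)
    then show "(\<integral>\<^sup>+w. ennreal (indicator {0<..} w *\<^sub>R ?f w) \<partial>lborel) = ennreal (Gamma (real j + 3/2))"
      using nn by simp
  qed (auto simp: less_imp_le[OF Gamma_real_pos])
  then show "set_integrable lborel {0<..} ?f"
    unfolding set_integrable_def by (rule integrable.intros)
  show "(LINT w:{0<..}|lborel. ?f w) = Gamma (real j + 3/2)"
    unfolding set_lebesgue_integral_def by (rule has_bochner_integral_integral_eq[OF hb])
qed

subsection \<open>The expansion with remainder\<close>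


lemma Gamma_half_Suc: "Gamma (real j + 3/2) = (real j + 1/2) * Gamma (real j + 1/2)"
proof -
  have "real j + 1/2 > 0" by simp
  then have "real j + 1/2 \<notin> \<int>\<^sub>\<le>\<^sub>0" using nonpos_Ints_nonpos by force
  from Gamma_plus1[OF this] show ?thesis by (simp add: add_ac)
qed

text \<open>This closed form links the two expressions for the Stirling coefficients.\<close>

lemma Gamma_half_fact: "Gamma (real n + 1/2) = sqrt pi * fact (2 * n) / (4 ^ n * fact n)"
proof (induction n)
  case 0
  then show ?case by (simp add: Gamma_one_half_real)
next
  case (Suc n)
  have "Gamma (real (Suc n) + 1/2) = (real n + 1/2) * (sqrt pi * fact (2 * n) / (4 ^ n * fact n))"
    using Gamma_half_Suc[of n] unfolding Suc.IH[symmetric] by (simp add: add_ac)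
  also have "\<dots> = sqrt pi * fact (2 * Suc n) / (4 ^ Suc n * fact (Suc n))"
    by (simp add: divide_simps) (simp add: algebra_simps)
  finally show ?case .
qed

text \<open>The explicit candidate for \<open>stirling_coeff\<close>, whose definite description
  gives no direct access to its values; \<open>stirling_coeff_eq\<close> identifies the two.\<close>

definition stirling_value :: "nat \<Rightarrow> real" where
  "stirling_value n = (-1) ^ n / (2 ^ n * fact n) * phi_power_deriv n"

lemma stirling_value_Gamma:
  "stirling_value n = (-2) ^ n / sqrt pi * (Gamma (real n + 1/2) / fact (2 * n)) * phi_power_deriv n"
proof -
  have "(4::real) ^ n = 2 ^ n * 2 ^ n" by (simp flip: power_mult_distrib)
  then show ?thesis
    by (simp add: stirling_value_def Gamma_half_fact power_minus[of 2])
qed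

text \<open>The divisor \<open>j + 1/2\<close> in \<open>width_coeff\<close> cancels against the
  recurrence for \<open>Gamma (j + 3/2)\<close>. The sign on the right undoes the one inside
  \<open>stirling_value\<close>.\<close>

lemma width_coeff_Gamma:
  "width_coeff j * Gamma (real j + 3/2) = sqrt (2 * pi) * ((-1) ^ j * stirling_value j)"
proof -
  have "real j + 1/2 \<noteq> 0" by (metis add_nonneg_pos half_gt_zero_iff less_irrefl of_nat_0_le_iff zero_less_one)
  then have "width_coeff j * Gamma (real j + 3/2) =
      sqrt 2 * 2 ^ j * phi_power_deriv j / fact (2 * j) * Gamma (real j + 1/2)"
    unfolding Gamma_half_Suc width_coeff_def by simp
  also have "\<dots> = sqrt 2 * 2 ^ j * phi_power_deriv j * sqrt pi / (4 ^ j * fact j)"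
    unfolding Gamma_half_fact by simp
  also have "(4::real) ^ j = 2 ^ j * 2 ^ j" by (simp flip: power_mult_distrib)
  also have "sqrt 2 * 2 ^ j * phi_power_deriv j * sqrt pi / (2 ^ j * 2 ^ j * fact j) =
      sqrt (2 * pi) * ((-1) ^ j * stirling_value j)"
    by (simp add: stirling_value_def real_sqrt_mult)
  finally show ?thesis .
qed

definition width_remainder :: "nat \<Rightarrow> real \<Rightarrow> real" where
  "width_remainder m u = stirling_width u - (\<Sum>j<m. width_coeff j * (u ^ j * sqrt u))"

text \<open>A contour-free form of the theorem: with \<open>u = w / x\<close> the j-th term of the
  width integrates to a multiple of \<open>x powr (- j - 1/2)\<close>, and the prefactor absorbs the
  half power.\<close>

lemma scaled_Gamma_expansion:
  assumes x: "x > 0"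
  shows "set_integrable lborel {0<..} (\<lambda>w. exp (- w) * width_remainder m (w / x))"
    and "scaled_Gamma x = (\<Sum>n<m. (-1) ^ n * stirling_value n / x ^ n) +
      sqrt (x / (2 * pi)) * (LINT w:{0<..}|lborel. exp (- w) * width_remainder m (w / x))"
proof -
  let ?t = "\<lambda>j w. width_coeff j / (x ^ j * sqrt x) * (exp (- w) * w powr (real j + 1/2))"
  have "exp (- w) * (width_coeff j * ((w / x) ^ j * sqrt (w / x))) = ?t j w" if "w \<in> {0<..}" for j w
    using that x by (simp add: power_divide real_sqrt_divide powr_add powr_realpow powr_half_sqrt)
  then have eq: "exp (- w) * width_remainder m (w / x) = exp (- w) * stirling_width (w / x) - (\<Sum>j<m. ?t j w)"
    if "w \<in> {0<..}" for w
    using that unfolding width_remainder_def right_diff_distrib sum_distrib_left by simp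
  have it: "set_integrable lborel {0<..} (?t j)" for j
    by (intro set_integrable_mult_right Gamma_half_integral)
  have iS: "set_integrable lborel {0<..} (\<lambda>w. \<Sum>j<m. ?t j w)"
    using it unfolding set_integrable_def scaleR_sum_right by (intro Bochner_Integration.integrable_sum) auto
  have "set_integrable lborel {0<..} (\<lambda>w. exp (- w) * stirling_width (w / x) - (\<Sum>j<m. ?t j w))"
    by (intro set_integral_diff scaled_Gamma_width_integral x iS)
  then show "set_integrable lborel {0<..} (\<lambda>w. exp (- w) * width_remainder m (w / x))"
    by (subst set_integrable_cong[OF refl refl eq]) auto
  have "(LINT w:{0<..}|lborel. exp (- w) * width_remainder m (w / x)) =
      (LINT w:{0<..}|lborel. exp (- w) * stirling_width (w / x) - (\<Sum>j<m. ?t j w))"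
    by (intro set_lebesgue_integral_cong) (auto simp: eq)
  also have "\<dots> = (LINT w:{0<..}|lborel. exp (- w) * stirling_width (w / x)) - (LINT w:{0<..}|lborel. \<Sum>j<m. ?t j w)"
    by (intro set_integral_diff scaled_Gamma_width_integral x iS)
  also have "(LINT w:{0<..}|lborel. \<Sum>j<m. ?t j w) = (\<Sum>j<m. LINT w:{0<..}|lborel. ?t j w)"
    using it unfolding set_lebesgue_integral_def set_integrable_def scaleR_sum_right
    by (intro Bochner_Integration.integral_sum) auto
  also have "\<dots> = (\<Sum>j<m. sqrt (2 * pi / x) * ((-1) ^ j * stirling_value j / x ^ j))"
  proof (intro sum.cong refl)
    fix j
    have L: "(LINT w:{0<..}|lborel. ?t j w) = width_coeff j * Gamma (real j + 3/2) / (x ^ j * sqrt x)"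
      by (simp only: set_integral_mult_right Gamma_half_integral(2)) simp
    show "(LINT w:{0<..}|lborel. ?t j w) = sqrt (2 * pi / x) * ((-1) ^ j * stirling_value j / x ^ j)"
      unfolding L width_coeff_Gamma by (simp add: real_sqrt_divide mult_ac)
  qed
  also have "\<dots> = sqrt (2 * pi / x) * (\<Sum>j<m. (-1) ^ j * stirling_value j / x ^ j)"
    by (simp add: sum_distrib_left)
  finally have I: "(LINT w:{0<..}|lborel. exp (- w) * width_remainder m (w / x)) =
      (LINT w:{0<..}|lborel. exp (- w) * stirling_width (w / x)) -
      sqrt (2 * pi / x) * (\<Sum>j<m. (-1) ^ j * stirling_value j / x ^ j)" .
  have "sqrt (x / (2 * pi)) * sqrt (2 * pi / x) = 1"
    using x by (simp flip: real_sqrt_mult)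
  then have "sqrt (x / (2 * pi)) * (sqrt (2 * pi / x) * y) = y" for y
    by (metis mult.assoc mult_1)
  then show "scaled_Gamma x = (\<Sum>n<m. (-1) ^ n * stirling_value n / x ^ n) +
      sqrt (x / (2 * pi)) * (LINT w:{0<..}|lborel. exp (- w) * width_remainder m (w / x))"
    unfolding I right_diff_distrib scaled_Gamma_width_integral(2)[OF x] by simp
qed

text \<open>At -1 and 1 the function \<open>exp t - t - 1\<close> equals \<open>1/e\<close> and
  \<open>e - 2\<close>, both above 1/4, so monotonicity puts the two real zeros in the unit disc.
  One contour for all small \<open>u\<close> makes a uniform kernel bound possible.\<close>

lemma stirling_contour_circlepath:
  assumes hol: "\<Phi> holomorphic_on {z. \<bar>Im z\<bar> < 2 * pi}"
    and re: "\<And>t::real. \<Phi> (of_real t) = of_real (stirling_phi t)"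
    and u: "0 < u" "u \<le> 1/4"
  shows "stirling_contour u \<Phi> (circlepath 0 1)"
proof -
  obtain a b :: real where ab: "a < 0" "0 < b" "\<And>t. exp t - t - 1 = u \<longleftrightarrow> t = a \<or> t = b"
    using stirling_h_real_zeros[OF u(1)] by metis
  have hab: "exp a - a - 1 = u" "exp b - b - 1 = u" using ab(3) by blast+
  have "1 / 4 < exp (-1) - (-1) - (1::real)" using exp_le by (simp add: exp_minus divide_simps)
  then have a1: "-1 < a"
    using exp_minus_id_strict_decreasing[of a "-1"] hab(1) u by (cases a "-1::real" rule: linorder_cases) auto
  have "1 / 4 < exp 1 - 1 - (1::real)"
    using exp_lower_Taylor_quadratic[of 1] by simp
  then have b1: "b < 1"
    using exp_minus_id_strict_increasing[of 1 b] hab(2) u by (cases b "1::real" rule: linorder_cases) auto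
  have ins: "inside (sphere (0::complex) 1) = ball 0 1"
    using inside_frontier_eq_interior[of "cball (0::complex) 1"] by simp
  have un: "sphere (0::complex) 1 \<union> ball 0 1 = cball 0 1" by auto
  have strip: "cball 0 1 \<subseteq> {z. \<bar>Im z\<bar> < 2 * pi}"
  proof
    fix z :: complex assume "z \<in> cball 0 1"
    then show "z \<in> {z. \<bar>Im z\<bar> < 2 * pi}" using abs_Im_le_cmod[of z] pi_gt3 by simp
  qed
  have zeros: "{z \<in> cball 0 1. stirling_h z - of_real u = 0} = {of_real a, of_real b}" (is "?L = ?R")
  proof (intro equalityI subsetI)
    fix z assume z: "z \<in> ?L"
    then have "Im z = 0" using stirling_h_zero_real[of z u] strip u by auto
    then obtain t where t: "z = of_real t" by (metis complex_is_Real_iff Reals_cases)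
    have "exp t - t - 1 = u" using z unfolding t by (simp add: stirling_h_of_real flip: of_real_diff)
    then show "z \<in> ?R" using ab(3) t by auto
  next
    fix z assume "z \<in> ?R"
    moreover have "stirling_h (of_real a) = of_real u" "stirling_h (of_real b) = of_real u"
      by (simp_all only: stirling_h_of_real hab)
    ultimately show "z \<in> ?L" using a1 b1 ab hab by auto
  qed
  have opn: "open {z. \<bar>Im z\<bar> < 2 * pi}"
    by (intro open_Collect_less continuous_intros)
  have "\<real> \<union> cball 0 1 \<subseteq> {z. \<bar>Im z\<bar> < 2 * pi}"
    using strip by (auto elim!: Reals_cases)
  then have an: "\<Phi> analytic_on (\<real> \<union> cball 0 1)"
    using analytic_on_subset[OF iffD2[OF analytic_on_open[OF opn] hol]] by blast
  have img: "path_image (circlepath (0::complex) 1) = sphere 0 1" by simp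
  show ?thesis
    unfolding stirling_contour_def Un_assoc img ins un
  proof (intro conjI ballI)
    show "\<exists>a b :: real. a < 0 \<and> 0 < b \<and> of_real a \<in> ball (0::complex) 1 \<and> of_real b \<in> ball (0::complex) 1 \<and>
        {z \<in> cball 0 1. stirling_h z - of_real u = 0} = {of_real a, of_real b}"
      using ab a1 b1 zeros by (intro exI[of _ a] exI[of _ b]) auto
  qed (use an re in \<open>auto simp: simple_path_circlepath intro!: winding_number_circlepath\<close>)
qed

subsection \<open>The asymptotic expansion\<close>


text \<open>By \<open>stirling_kernel_eq\<close> the remainder is \<open>u ^ m * sqrt u\<close>
  times the kernel, and on the unit circle the kernel is bounded uniformly in small
  \<open>u\<close>.\<close>

lemma width_remainder_bound_small:
  obtains K d where "0 \<le> K" "0 < d"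
    "\<And>u. 0 < u \<Longrightarrow> u \<le> d \<Longrightarrow> \<bar>width_remainder m u\<bar> \<le> K * (u ^ m * sqrt u)"
proof -
  obtain \<Phi> where hol: "\<Phi> holomorphic_on {z. \<bar>Im z\<bar> < 2 * pi}"
    and re: "\<And>t::real. \<Phi> (of_real t) = of_real (stirling_phi t)"
    using stirling_phi_extends by blast
  note contour = stirling_contour_circlepath[OF hol re]
  let ?S = "sphere (0::complex) 1"
  \<comment> \<open>The choice 1/4 serves only to obtain the relation between \<open>\<Phi>\<close>
    and \<open>h\<close> on the circle; that relation does not involve \<open>u\<close>.\<close>
  have "stirling_contour (1/4) \<Phi> (circlepath 0 1)" by (rule contour) auto
  then obtain S where S: "?S \<subseteq> S" and holS: "\<Phi> holomorphic_on S"
    and phi2: "\<forall>z\<in>S. (\<Phi> z)\<^sup>2 * (2 * stirling_h z) = z\<^sup>2"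
    by (rule stirling_contour_domain) auto
  have nz: "\<Phi> z \<noteq> 0 \<and> stirling_h z \<noteq> 0 \<and> z \<noteq> 0" if "z \<in> ?S" for z
  proof -
    have "(\<Phi> z)\<^sup>2 * (2 * stirling_h z) = z\<^sup>2" "z \<noteq> 0" using phi2 S that by auto
    then show ?thesis by auto
  qed
  have conth: "continuous_on ?S stirling_h"
    by (intro holomorphic_on_imp_continuous_on holomorphic_intros)
  have contphi: "continuous_on ?S \<Phi>"
    using holomorphic_on_imp_continuous_on[OF holS] S continuous_on_subset by blast
  define G where "G = (\<lambda>z. z * (exp z - 1) * stirling_h_sqrt \<Phi> z powi (- 2 * int m - 1))"
  have contG: "continuous_on ?S G"
    unfolding G_def stirling_h_sqrt_def using nz
    by (intro continuous_intros contphi) auto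
  have "compact ?S" "?S \<noteq> {}" by auto
  then have "bounded (G ` ?S)" by (intro compact_imp_bounded compact_continuous_image contG)
  then obtain B where B: "\<And>z. z \<in> ?S \<Longrightarrow> norm (G z) \<le> B"
    unfolding bounded_iff by blast
  have B0: "0 \<le> B" using B[of 1] norm_ge_zero[of "G 1"] by (simp del: norm_ge_zero)
  obtain z0 where z0: "z0 \<in> ?S" "\<And>z. z \<in> ?S \<Longrightarrow> norm (stirling_h z0) \<le> norm (stirling_h z)"
  proof -
    have "\<exists>x\<in>?S. \<forall>y\<in>?S. norm (stirling_h x) \<le> norm (stirling_h y)"
      by (intro continuous_attains_inf continuous_on_norm conth) auto
    then show thesis using that by blast
  qed
  \<comment> \<open>Half the minimum of \<open>norm h\<close> on the circle: for \<open>u\<close> at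
    most \<open>e\<close>, the denominator \<open>h - u\<close> stays at least \<open>e\<close> in
    norm.\<close>
  define e where "e = norm (stirling_h z0) / 2"
  have e0: "e > 0" using nz[OF z0(1)] by (simp add: e_def)
  have bound: "\<bar>width_remainder m u\<bar> \<le> B / e * (u ^ m * sqrt u)" if u: "0 < u" "u \<le> min e (1/4)" for u
  proof -
    let ?I = "\<lambda>z. z * deriv stirling_h z / (stirling_h z - of_real u)
                              * stirling_h_sqrt \<Phi> z powi (- 2 * int m - 1)"
    have I: "?I z = G z / (stirling_h z - of_real u)" for z
      by (simp add: G_def deriv_stirling_h)
    have lower: "e \<le> norm (stirling_h z - of_real u)" if "z \<in> ?S" for z
      using norm_triangle_ineq2[of "stirling_h z" "of_real u"] z0(2)[OF that] u by (simp add: e_def)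
    have "continuous_on ?S ?I"
      unfolding I by (intro continuous_intros contG conth) (use lower e0 in force)
    then have "(?I has_contour_integral contour_integral (circlepath 0 1) ?I) (circlepath 0 1)"
      by (intro has_contour_integral_integral contour_integrable_continuous_circlepath) simp
    \<comment> \<open>The circumference \<open>2 * pi\<close> cancels the normalisation of the
      kernel.\<close>
    then have "norm (contour_integral (circlepath 0 1) ?I) \<le> B / e * (2 * pi * 1)"
    proof (rule has_contour_integral_bound_circlepath)
      fix z :: complex assume "norm (z - 0) = 1"
      then have z: "z \<in> ?S" by simp
      have "norm (G z) / norm (stirling_h z - of_real u) \<le> B / e"
        by (intro frac_le B lower z B0 e0)
      then show "norm (?I z) \<le> B / e" unfolding I norm_divide .
    qed (use B0 e0 in auto)
    then have "norm (stirling_kernel \<Phi> (circlepath 0 1) m u) \<le> B / e"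
      by (simp add: stirling_kernel_def norm_mult norm_divide field_simps)
    also have "stirling_kernel \<Phi> (circlepath 0 1) m u = of_real (width_remainder m u / (u ^ m * sqrt u))"
      using stirling_kernel_eq[OF contour, of u m] u by (simp add: width_remainder_def)
    finally have "\<bar>width_remainder m u\<bar> / (u ^ m * sqrt u) \<le> B / e"
      using u by (simp only: norm_of_real abs_divide abs_mult abs_of_pos zero_less_power real_sqrt_gt_zero)
    then show ?thesis using u by (simp add: pos_divide_le_eq)
  qed
  show thesis
    by (rule that[of "B / e" "min e (1/4)"]) (use bound e0 B0 in auto)
qed

text \<open>Beyond \<open>d\<close>, the width grows at most linearly and the subtracted terms have
  lower order, so for \<open>m > 0\<close> all are dominated by
  \<open>u ^ m * sqrt u\<close>.\<close>

lemma width_remainder_bound: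
  assumes "m > 0"
  obtains K where "\<And>u. 0 < u \<Longrightarrow> \<bar>width_remainder m u\<bar> \<le> K * (u ^ m * sqrt u)"
proof -
  obtain K d where K: "0 \<le> K" "0 < d"
    "\<And>u. 0 < u \<Longrightarrow> u \<le> d \<Longrightarrow> \<bar>width_remainder m u\<bar> \<le> K * (u ^ m * sqrt u)"
    using width_remainder_bound_small by metis
  \<comment> \<open>The numerator collects the bounds at \<open>u = d\<close>. Scaling by
    \<open>r = u / d\<close>, at least 1, multiplies each of them by at most
    \<open>r ^ m * sqrt r\<close>.\<close>
  define M where "M = (2 * d + 3 + (\<Sum>j<m. \<bar>width_coeff j\<bar> * (d ^ j * sqrt d))) / (d ^ m * sqrt d)"
  have M0: "0 \<le> M" unfolding M_def using K(2) by (intro divide_nonneg_nonneg add_nonneg_nonneg sum_nonneg) auto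
  have "\<bar>width_remainder m u\<bar> \<le> (K + M) * (u ^ m * sqrt u)" if "0 < u" for u
  proof (cases "u \<le> d")
    case True
    have "\<bar>width_remainder m u\<bar> \<le> K * (u ^ m * sqrt u)" using K(3) that True by blast
    also have "\<dots> \<le> (K + M) * (u ^ m * sqrt u)"
      using M0 that by (intro mult_right_mono) auto
    finally show ?thesis .
  next
    case False
    define r where "r = u / d"
    have r: "r \<ge> 1" "u = d * r" using False K(2) by (auto simp: r_def)
    let ?R = "r ^ m * sqrt r"
    have pow: "r ^ j * sqrt r \<le> ?R" if "j \<le> m" for j
      using r that by (intro mult_right_mono power_increasing) auto
    have "1 \<le> sqrt r" using r by simp
    then have "r * 1 \<le> r ^ 1 * sqrt r" using r by (intro mult_mono) auto
    then have rR: "r \<le> ?R" using pow[of 1] assms by simp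
    have "\<bar>width_remainder m u\<bar> \<le> \<bar>stirling_width u\<bar> + (\<Sum>j<m. \<bar>width_coeff j * (u ^ j * sqrt u)\<bar>)"
      unfolding width_remainder_def by (rule order_trans[OF abs_triangle_ineq4 add_left_mono[OF sum_abs]])
    also have "\<dots> \<le> (2 * d + 3) * ?R + (\<Sum>j<m. \<bar>width_coeff j\<bar> * (d ^ j * sqrt d) * ?R)"
    proof (intro add_mono sum_mono)
      have "\<bar>stirling_width u\<bar> \<le> 2 * u + 3" using stirling_width_bounds[OF that] by simp
      also have "\<dots> \<le> (2 * d + 3) * r" using r K(2) by (simp add: algebra_simps)
      also have "\<dots> \<le> (2 * d + 3) * ?R" using rR K(2) by (intro mult_left_mono) auto
      finally show "\<bar>stirling_width u\<bar> \<le> (2 * d + 3) * ?R" .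
    next
      fix j assume "j \<in> {..<m}"
      have "\<bar>width_coeff j * (u ^ j * sqrt u)\<bar> = \<bar>width_coeff j\<bar> * (d ^ j * sqrt d) * (r ^ j * sqrt r)"
        using r K(2) by (simp add: abs_mult power_mult_distrib real_sqrt_mult)
      also have "\<dots> \<le> \<bar>width_coeff j\<bar> * (d ^ j * sqrt d) * ?R"
        using \<open>j \<in> {..<m}\<close> K(2) by (intro mult_left_mono pow) auto
      finally show "\<bar>width_coeff j * (u ^ j * sqrt u)\<bar> \<le> \<bar>width_coeff j\<bar> * (d ^ j * sqrt d) * ?R" .
    qed
    also have "\<dots> = M * (d ^ m * sqrt d) * ?R"
    proof -
      have "M * (d ^ m * sqrt d) = 2 * d + 3 + (\<Sum>j<m. \<bar>width_coeff j\<bar> * (d ^ j * sqrt d))"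
        using K(2) by (simp add: M_def)
      then show ?thesis by (simp only: sum_distrib_right distrib_right)
    qed
    also have "\<dots> = M * (u ^ m * sqrt u)"
      using r K(2) by (simp add: power_mult_distrib real_sqrt_mult)
    also have "\<dots> \<le> (K + M) * (u ^ m * sqrt u)"
      using K(1) that by (intro mult_right_mono) auto
    finally show ?thesis .
  qed
  then show thesis by (rule that)
qed

text \<open>Integrating the pointwise bound on the width remainder gives a constant over
  \<open>x ^ m * sqrt x\<close>; the prefactor cancels \<open>sqrt x\<close>.\<close>

lemma scaled_Gamma_remainder_bigo:
  assumes "m > 0"
  shows "(\<lambda>x. scaled_Gamma x - (\<Sum>n<m. (-1) ^ n * stirling_value n / x ^ n)) \<in> O[at_top](\<lambda>x. 1 / x ^ m)"
proof -
  obtain K where K: "\<And>u. 0 < u \<Longrightarrow> \<bar>width_remainder m u\<bar> \<le> K * (u ^ m * sqrt u)"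
    using width_remainder_bound[OF assms] by metis
  have "norm (scaled_Gamma x - (\<Sum>n<m. (-1) ^ n * stirling_value n / x ^ n))
      \<le> K * Gamma (real m + 3/2) / sqrt (2 * pi) * norm (1 / x ^ m)" if x: "x > 0" for x
  proof -
    let ?b = "\<lambda>w. K / (x ^ m * sqrt x) * (exp (- w) * w powr (real m + 1/2))"
    have "norm (LINT w:{0<..}|lborel. exp (- w) * width_remainder m (w / x)) \<le>
        (LINT w:{0<..}|lborel. norm (exp (- w) * width_remainder m (w / x)))"
      by (intro set_integral_norm_bound scaled_Gamma_expansion x)
    also have "\<dots> \<le> (LINT w:{0<..}|lborel. ?b w)"
    proof (rule set_integral_mono)
      show "set_integrable lborel {0<..} (\<lambda>w. norm (exp (- w) * width_remainder m (w / x)))"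
        by (intro set_integrable_norm scaled_Gamma_expansion x)
      show "set_integrable lborel {0<..} ?b"
        by (intro set_integrable_mult_right Gamma_half_integral)
      fix w :: real assume w: "w \<in> {0<..}"
      have "norm (exp (- w) * width_remainder m (w / x)) \<le> exp (- w) * (K * ((w / x) ^ m * sqrt (w / x)))"
        unfolding norm_mult using K[of "w / x"] w x by (auto intro!: mult_mono)
      also have "\<dots> = ?b w"
        using w x by (simp add: power_divide real_sqrt_divide powr_add powr_realpow powr_half_sqrt)
      finally show "norm (exp (- w) * width_remainder m (w / x)) \<le> ?b w" .
    qed
    also have "\<dots> = K / (x ^ m * sqrt x) * Gamma (real m + 3/2)"
      by (simp only: set_integral_mult_right Gamma_half_integral(2))
    finally have "sqrt (x / (2 * pi)) * norm (LINT w:{0<..}|lborel. exp (- w) * width_remainder m (w / x))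
        \<le> sqrt (x / (2 * pi)) * (K / (x ^ m * sqrt x) * Gamma (real m + 3/2))"
      using x by (intro mult_left_mono) auto
    moreover have "sqrt (x / (2 * pi)) * (K / (x ^ m * sqrt x) * Gamma (real m + 3/2)) =
        K * Gamma (real m + 3/2) / sqrt (2 * pi) * norm (1 / x ^ m)"
      using x by (simp add: real_sqrt_divide)
    moreover have "scaled_Gamma x - (\<Sum>n<m. (-1) ^ n * stirling_value n / x ^ n) =
        sqrt (x / (2 * pi)) * (LINT w:{0<..}|lborel. exp (- w) * width_remainder m (w / x))"
      using scaled_Gamma_expansion(2)[OF x, of m] by simp
    ultimately show ?thesis using x by (simp only: norm_mult) simp
  qed
  then show ?thesis
    by (intro bigoI[where c = "K * Gamma (real m + 3/2) / sqrt (2 * pi)"])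
       (auto intro: eventually_mono[OF eventually_gt_at_top[of 0]])
qed

lemma scaled_Gamma_asymp:
  "asymp_power_expansion scaled_Gamma (\<lambda>n. (-1) ^ n * stirling_value n)"
  unfolding asymp_power_expansion_def
proof
  fix N
  show "(\<lambda>x. scaled_Gamma x - (\<Sum>n<N. (-1) ^ n * stirling_value n / x ^ n)) \<in> O[at_top](\<lambda>x. 1 / x ^ N)"
  proof (cases "N > 0")
    case False
    \<comment> \<open>Order 0 demands boundedness of \<open>scaled_Gamma\<close> itself, taken from
      the estimate of order 1.\<close>
    have "(\<lambda>x. scaled_Gamma x - stirling_value 0) \<in> O[at_top](\<lambda>x. 1 / x)"
      using scaled_Gamma_remainder_bigo[of 1] by simp
    also have "(\<lambda>x::real. 1 / x) \<in> O[at_top](\<lambda>x. 1)"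
      by (intro bigoI[where c = 1] eventually_mono[OF eventually_ge_at_top[of 1]]) auto
    finally have "(\<lambda>x. scaled_Gamma x - stirling_value 0) \<in> O[at_top](\<lambda>x. 1)" .
    from sum_in_bigo(1)[OF this, of "\<lambda>_. stirling_value 0"] show ?thesis
      using False by simp
  qed (rule scaled_Gamma_remainder_bigo)
qed

section \<open>Uniqueness of expansions and identification of the coefficients\<close>

text \<open>If the coefficients below \<open>N\<close> agree, the truncations after index
  \<open>N\<close> differ by \<open>(b N - a N) / x ^ N\<close>, which can be of order
  \<open>1 / x ^ Suc N\<close> only when it vanishes.\<close>

lemma asymp_power_expansion_unique:
  assumes "asymp_power_expansion f a" "asymp_power_expansion f b"
  shows "a = b"
proof
  fix N
  show "a N = b N"
  proof (induction N rule: less_induct)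
    case (less N)
    have "(\<lambda>x. (f x - (\<Sum>n<Suc N. a n / x ^ n)) - (f x - (\<Sum>n<Suc N. b n / x ^ n))) \<in> O[at_top](\<lambda>x. 1 / x ^ Suc N)"
      using assms unfolding asymp_power_expansion_def
      by (intro sum_in_bigo(2)[of "\<lambda>x. f x - (\<Sum>n<Suc N. a n / x ^ n)"]) blast+
    also have "(\<lambda>x. (f x - (\<Sum>n<Suc N. a n / x ^ n)) - (f x - (\<Sum>n<Suc N. b n / x ^ n))) =
        (\<lambda>x. (b N - a N) / x ^ N)"
      using less by (simp add: diff_divide_distrib)
    finally obtain c where "eventually (\<lambda>x. norm ((b N - a N) / x ^ N) \<le> c * norm (1 / x ^ Suc N)) at_top"
      by (elim landau_o.bigE)
    then have "eventually (\<lambda>x. \<bar>b N - a N\<bar> * x \<le> c) at_top"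
      using eventually_gt_at_top[of 0]
    proof eventually_elim
      case (elim x)
      then show ?case by (simp add: field_simps)
    qed
    then obtain x0 where x0: "\<And>x. x \<ge> x0 \<Longrightarrow> \<bar>b N - a N\<bar> * x \<le> c"
      unfolding eventually_at_top_linorder by blast
    show "a N = b N"
    proof (rule ccontr)
      assume "a N \<noteq> b N"
      then have p: "\<bar>b N - a N\<bar> > 0" by simp
      define y where "y = max x0 ((c + 1) / \<bar>b N - a N\<bar>)"
      have "(c + 1) / \<bar>b N - a N\<bar> \<le> y" by (simp add: y_def)
      then have "c + 1 \<le> \<bar>b N - a N\<bar> * y" using p by (simp add: pos_divide_le_eq mult.commute)
      moreover have "\<bar>b N - a N\<bar> * y \<le> c" by (rule x0) (simp add: y_def)
      ultimately show False by simp
    qed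
  qed
qed

lemma stirling_coeff_eq: "stirling_coeff = stirling_value"
  unfolding stirling_coeff_def
proof (rule the_equality)
  fix \<gamma> assume "asymp_power_expansion scaled_Gamma (\<lambda>n. (-1) ^ n * \<gamma> n)"
  from asymp_power_expansion_unique[OF this scaled_Gamma_asymp]
  have "(-1) ^ n * \<gamma> n = (-1) ^ n * stirling_value n" for n by metis
  then show "\<gamma> = stirling_value" by (simp add: fun_eq_iff)
qed (rule scaled_Gamma_asymp)

theorem mainTheorem2:
  fixes x :: real and m :: nat
  assumes "x > 0" and "m > 0"
  shows "(\<forall>n. stirling_coeff n
            = (-2) ^ n / sqrt pi * (Gamma (real n + 1/2) / fact (2 * n))
                * (deriv ^^ (2 * n)) (\<lambda>t. stirling_phi t ^ (2 * n + 1)) 0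
          \<and> (-2) ^ n / sqrt pi * (Gamma (real n + 1/2) / fact (2 * n))
                * (deriv ^^ (2 * n)) (\<lambda>t. stirling_phi t ^ (2 * n + 1)) 0
            = (-1) ^ n / (2 ^ n * fact n)
                * (deriv ^^ (2 * n)) (\<lambda>t. stirling_phi t ^ (2 * n + 1)) 0)
       \<and> (\<forall>\<Phi> C. (\<forall>w>0. stirling_contour (w / x) (\<Phi> w) (C w)) \<longrightarrow>
            set_integrable lborel {0<..} (stirling_integrand \<Phi> C m x) \<and>
            complex_of_real (scaled_Gamma x)
              = of_real (\<Sum>n<m. (-1) ^ n * stirling_coeff n / x ^ n)
                + stirling_remainder \<Phi> C m x)"
proof (intro conjI allI impI)
  fix n
  have v: "stirling_coeff n = (-2) ^ n / sqrt pi * (Gamma (real n + 1/2) / fact (2 * n)) * phi_power_deriv n"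
    "stirling_coeff n = (-1) ^ n / (2 ^ n * fact n) * phi_power_deriv n"
    unfolding stirling_coeff_eq by (rule stirling_value_Gamma, rule stirling_value_def)
  show "stirling_coeff n
            = (-2) ^ n / sqrt pi * (Gamma (real n + 1/2) / fact (2 * n))
                * (deriv ^^ (2 * n)) (\<lambda>t. stirling_phi t ^ (2 * n + 1)) 0"
    using v(1) unfolding phi_power_deriv_def .
  show "(-2) ^ n / sqrt pi * (Gamma (real n + 1/2) / fact (2 * n))
                * (deriv ^^ (2 * n)) (\<lambda>t. stirling_phi t ^ (2 * n + 1)) 0
            = (-1) ^ n / (2 ^ n * fact n)
                * (deriv ^^ (2 * n)) (\<lambda>t. stirling_phi t ^ (2 * n + 1)) 0"
    using v unfolding phi_power_deriv_def by (rule trans[OF sym])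
next
  fix \<Phi> C assume C: "\<forall>w>0. stirling_contour (w / x) (\<Phi> w) (C w)"
  let ?g = "\<lambda>w. exp (- w) * width_remainder m (w / x)"
  \<comment> \<open>By \<open>stirling_kernel_eq\<close> every admissible choice of contours and
    continuations gives the same real function of \<open>w\<close>, so its integrability and
    integral come from \<open>scaled_Gamma_expansion\<close>.\<close>
  have eq: "stirling_integrand \<Phi> C m x w = of_real (x ^ m * sqrt x) * of_real (?g w)" if "w \<in> {0<..}" for w
  proof -
    have w: "w > 0" using that by simp
    have "stirling_integrand \<Phi> C m x w =
        of_real (exp (- w) * w powr (real m + 1/2) * (width_remainder m (w / x) / ((w / x) ^ m * sqrt (w / x))))"
      using stirling_kernel_eq[of "w / x" "\<Phi> w" "C w" m] C w \<open>x > 0\<close>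
      by (simp add: stirling_integrand_def width_remainder_def)
    also have "exp (- w) * w powr (real m + 1/2) * (width_remainder m (w / x) / ((w / x) ^ m * sqrt (w / x)))
        = (x ^ m * sqrt x) * ?g w"
      using w \<open>x > 0\<close> by (simp add: power_divide real_sqrt_divide powr_add powr_realpow powr_half_sqrt)
    finally show ?thesis by simp
  qed
  have ig: "set_integrable lborel {0<..} (\<lambda>w. complex_of_real (?g w))"
  proof -
    have "(\<lambda>w. indicator {0<..} w *\<^sub>R complex_of_real (?g w)) =
        (\<lambda>w. complex_of_real (indicator {0<..} w *\<^sub>R ?g w))"
      by (simp add: scaleR_conv_of_real)
    then show ?thesis
      using scaled_Gamma_expansion(1)[OF \<open>x > 0\<close>, of m]
      by (simp only: set_integrable_def complex_of_real_integrable_eq)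
  qed
  then have "set_integrable lborel {0<..} (\<lambda>w. of_real (x ^ m * sqrt x) * complex_of_real (?g w))"
    by (intro set_integrable_mult_right)
  then show "set_integrable lborel {0<..} (stirling_integrand \<Phi> C m x)"
    by (subst set_integrable_cong[OF refl refl eq]) auto
  have "set_lebesgue_integral lborel {0<..} (stirling_integrand \<Phi> C m x) =
      (LINT w:{0<..}|lborel. of_real (x ^ m * sqrt x) * complex_of_real (?g w))"
    by (intro set_lebesgue_integral_cong) (auto simp: eq)
  also have "\<dots> = of_real (x ^ m * sqrt x) * (LINT w:{0<..}|lborel. complex_of_real (?g w))"
    by (rule set_integral_mult_right)
  also have "(LINT w:{0<..}|lborel. complex_of_real (?g w)) = of_real (LINT w:{0<..}|lborel. ?g w)"
    by (rule set_integral_complex_of_real)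
  finally have "stirling_remainder \<Phi> C m x =
      of_real (1 / (x ^ m * sqrt (2 * pi)) * (x ^ m * sqrt x * (LINT w:{0<..}|lborel. ?g w)))"
    unfolding stirling_remainder_def by simp
  also have "1 / (x ^ m * sqrt (2 * pi)) * (x ^ m * sqrt x * y) = sqrt (x / (2 * pi)) * y" for y
    using \<open>x > 0\<close> by (simp add: real_sqrt_divide)
  finally show "complex_of_real (scaled_Gamma x) =
      of_real (\<Sum>n<m. (-1) ^ n * stirling_coeff n / x ^ n) + stirling_remainder \<Phi> C m x"
    unfolding stirling_coeff_eq scaled_Gamma_expansion(2)[OF \<open>x > 0\<close>, of m] by simp
qed

end
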